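(* The map $\eta\mapsto\mu_\eta\big(\big[-\frac12,\frac12\big]\big)$ is continuous on $[1,2]$ and monotone on each matching interval. More precisely, if $J\subseteq[1,2]$ is a matching interval on which the matching index is $m$, then for all $\eta\in J$ $$\mu_\eta\Big(\Big[-\frac12,\frac12\Big]\Big)=\frac{2^{m-1}}{2^m-1}\Big(\frac{c}{\eta}+K\Big),$$ where $c$ and $K$ are constants depending only on the digits $w_n=d_{\eta,n}(1)$, $1\le n\le m-1$ (which are the same for all $\eta\in J$), given explicitly as follows: if $m=1$, then $c=1$ and $K=0$; if $m\ge2$, then $$c=\#\{2\le k\le m-1: w_k=0\}-\#\{2\le k\le m-1: w_k=1\},$$ $$K=v(w_1\cdots w_{m-1})+\sum_{1\le k\le m-1,\ w_k=1}v(w_1\cdots w_k)-\sum_{1\le k\le m-1,\ w_k=0}v(w_1\cdots w_k).$$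
   Context: For $\eta\in[1,2]$ the symmetric doubling map $S_\eta:[-1,1]\to[-1,1]$ is $S_\eta(x)=2x-d_1(x)\eta$, where $d_1(x)=-1$ if $x<-\frac12$, $d_1(x)=0$ if $x\in[-\frac12,\frac12]$, and $d_1(x)=1$ if $x>\frac12$. For $n\ge1$ put $d_{\eta,n}(x)=d_1(S_\eta^{n-1}(x))$. The matching index is $m(\eta)=\inf\{m\ge1: S_\eta^m(1)=S_\eta^m(1-\eta)\}$ ($=\infty$ if there is no such $m$); $S_\eta$ has matching if $m(\eta)<\infty$. A matching interval is a maximal nondegenerate interval $J\subseteq[1,2]$ of parameters on which the matching index is finite and constant, equal to $m$ say, and on which the word $d_{\eta,1}(1)\cdots d_{\eta,m}(1)$ does not depend on $\eta\in J$. For $\eta\in(1,2]$, $\mu_\eta$ denotes the unique $S_\eta$-invariant Borel probability measure on $[-1,1]$ that is absolutely continuous with respect to Lebesgue measure. For $\eta=1$, $\mu_1$ is normalised Lebesgue measure on $[-1,1]$. For a finite word $u=u_1\cdots u_k$ of digits, $v(u)=\sum_{j=1}^k u_j2^{-j}$. *)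

theory Defs
  imports "HOL-Probability.Probability" "HOL-Library.Extended_Nat"
begin

definition first_digit :: "real \<Rightarrow> int" where
  "first_digit x = (if x < -1/2 then -1 else if x \<le> 1/2 then 0 else 1)"

text \<open>Defined on all of \<open>\<real>\<close>; it maps \<open>{-1..1}\<close> into itself for \<open>\<eta> \<in> {1..2}\<close>.\<close>
definition sym_doubling :: "real \<Rightarrow> real \<Rightarrow> real" where
  "sym_doubling \<eta> x = 2 * x - real_of_int (first_digit x) * \<eta>"

definition digit :: "real \<Rightarrow> nat \<Rightarrow> real \<Rightarrow> int" where
  "digit \<eta> n x = first_digit ((sym_doubling \<eta> ^^ (n - 1)) x)"

text \<open>The word \<open>d\<^sub>1 \<dots> d\<^sub>n\<close>. Digits and words are numbered from 1, so the \<open>j\<close>-th letter of a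
  word \<open>u\<close> is \<open>u ! (j - 1)\<close>.\<close>
definition digit_word :: "real \<Rightarrow> nat \<Rightarrow> real \<Rightarrow> int list" where
  "digit_word \<eta> n x = map (\<lambda>k. digit \<eta> k x) [1..<Suc n]"

text \<open>The infimum of the empty set in \<^typ>\<open>enat\<close> is \<open>\<infinity>\<close>.\<close>
definition matching_index :: "real \<Rightarrow> enat" where
  "matching_index \<eta> =
     Inf {enat m |m. 1 \<le> m \<and> (sym_doubling \<eta> ^^ m) 1 = (sym_doubling \<eta> ^^ m) (1 - \<eta>)}"

definition constant_matching_on :: "nat \<Rightarrow> real set \<Rightarrow> bool" where
  "constant_matching_on m J \<longleftrightarrow>
     is_interval J \<and> J \<subseteq> {1..2} \<and> (\<exists>a\<in>J. \<exists>b\<in>J. a < b) \<and>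
     (\<forall>\<eta>\<in>J. matching_index \<eta> = enat m) \<and>
     (\<exists>w. \<forall>\<eta>\<in>J. digit_word \<eta> m 1 = w)"

definition matching_interval :: "nat \<Rightarrow> real set \<Rightarrow> bool" where
  "matching_interval m J \<longleftrightarrow>
     constant_matching_on m J \<and>
     (\<forall>J' m'. constant_matching_on m' J' \<and> J \<subseteq> J' \<longrightarrow> J' = J)"

definition invariant_ac_prob :: "real \<Rightarrow> real measure \<Rightarrow> bool" where
  "invariant_ac_prob \<eta> M \<longleftrightarrow>
     sets M = sets (restrict_space borel {-1..1}) \<and>
     prob_space M \<and>
     absolutely_continuous (restrict_space lborel {-1..1}) M \<and>
     sym_doubling \<eta> \<in> measurable M M \<and> distr M M (sym_doubling \<eta>) = M"

text \<open>For \<open>\<eta> = 1\<close> both halves of \<open>{-1..1}\<close> are invariant, so the absolutely continuous invariant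
  probability measure is not unique and normalised Lebesgue measure is singled out.\<close>
definition inv_measure :: "real \<Rightarrow> real measure" where
  "inv_measure \<eta> =
     (if \<eta> = 1 then uniform_measure (restrict_space lborel {-1..1}) {-1..1}
      else (THE M. invariant_ac_prob \<eta> M))"

definition word_value :: "int list \<Rightarrow> real" where
  "word_value u = (\<Sum>j = 1..length u. real_of_int (u ! (j - 1)) / 2 ^ j)"

text \<open>The two constants for matching index \<open>m\<close> as functions of the word \<open>w\<close> of length \<open>m - 1\<close>.
  The prefix \<open>w\<^sub>1 \<dots> w\<^sub>k\<close> is \<^term>\<open>take k w\<close>.\<close>
definition const_c :: "nat \<Rightarrow> int list \<Rightarrow> int" where
  "const_c m w =
     (if m = 1 then 1
      else int (card {k \<in> {2..m - 1}. w ! (k - 1) = 0})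
         - int (card {k \<in> {2..m - 1}. w ! (k - 1) = 1}))"

definition const_K :: "nat \<Rightarrow> int list \<Rightarrow> real" where
  "const_K m w =
     (if m = 1 then 0
      else word_value w
         + (\<Sum>k \<in> {k \<in> {1..m - 1}. w ! (k - 1) = 1}. word_value (take k w))
         - (\<Sum>k \<in> {k \<in> {1..m - 1}. w ! (k - 1) = 0}. word_value (take k w)))"

end

theory Submission
  imports Defs
begin

text \<open>
  Everything rests on the congruence \<open>S\<^sub>\<eta> x \<equiv> 2 x\<close> modulo \<open>\<eta>\<close>: the map \<open>S\<^sub>\<eta>\<close> covers the doubling map of
  the circle \<open>\<real>/\<eta>\<int>\<close>, and since \<open>[-1,1]\<close> has length \<open>2\<close>, for \<open>\<eta> > 1\<close> a point of that circle has one or two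
  representatives in \<open>[-1,1]\<close>. The double fibres are the pairs \<open>(x, x - \<eta>)\<close> with \<open>\<eta> - 1 \<le> x \<le> 1\<close>. One step of
  \<open>S\<^sub>\<eta>\<close> maps such a pair to such a pair, unless \<open>1/2 < x < \<eta> - 1/2\<close>, in which case the two points merge.
  In terms of the distance \<open>\<parallel>\<cdot>\<parallel>\<close> to the nearest integer, the pair of \<open>x\<close> therefore survives until the first
  \<open>j\<close> with \<open>\<parallel>2\<^sup>j x / \<eta>\<parallel> > 1 / (2 \<eta>)\<close> (lemmas \<open>pair_orbit\<close> and \<open>pair_merges\<close>). For \<open>x = 1\<close> the merging time is
  the matching index.

  \<^bold>\<open>Uniqueness.\<close> A periodic set pulled back by \<open>x \<mapsto> 2\<^sup>n x\<close> becomes equidistributed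
  (\<open>equidistribution_set\<close>). Hence almost every pair merges, and an absolutely continuous invariant
  probability gives every \<open>\<eta>\<close>-periodic set its mean density. For large \<open>n\<close> the event \<open>S\<^sub>\<eta>\<^sup>n x \<in> A\<close> agrees, up to a
  small set, with an \<open>\<eta>\<close>-periodic event, so that the measure of \<open>A\<close> is a limit of numbers that do not
  depend on the measure (\<open>measure_as_limit_of_means\<close>).

  \<^bold>\<open>The invariant density.\<close> Let \<open>t\<^sub>n = S\<^sub>\<eta>\<^sup>n 1\<close>, and let \<open>E(t)\<close> be the sum of Lebesgue measure on \<open>[t - \<eta>, t]\<close> and
  its mirror image. The push-forward of \<open>E(t)\<close> is \<open>(E(S\<^sub>\<eta> t) + E(1)) / 2\<close> if the pair of \<open>t\<close> survives one
  step, and \<open>E(1)\<close> if it merges (\<open>window_preimage\<close>). So the sum of \<open>2\<^sup>-\<^sup>n E(t\<^sub>n)\<close> over all \<open>n\<close> before the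
  matching time is invariant, by telescoping.

  \<^bold>\<open>The mass of the central interval.\<close> The measure \<open>E(t\<^sub>n)\<close> gives \<open>[-1/2, 1/2]\<close> the mass
  \<open>2 \<eta> min(\<parallel>2\<^sup>n / \<eta>\<parallel>, 1 / (2 \<eta>)) + 1\<close>. So \<open>\<mu>\<^sub>\<eta>([-1/2, 1/2])\<close> is \<open>1 / (2 \<eta>)\<close> plus a weighted average of
  continuous functions of \<open>\<eta>\<close>, taken up to the matching time. The matching time jumps, but only at parameters where
  \<open>\<parallel>2\<^sup>k / \<eta>\<parallel> = 1 / (2 \<eta>)\<close> for some \<open>k\<close>. There \<open>2\<^sup>k\<^sup>+\<^sup>1 / \<eta> \<equiv> \<plusminus>1 / \<eta>\<close> modulo \<open>1\<close>, the averaged sequence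
  restarts, and its infinite average equals the one stopped after \<open>k + 1\<close> terms
  (\<open>clipped_average_eq_partial_average\<close>); this gives continuity. On a matching interval
  \<open>t\<^sub>n = 2\<^sup>n (1 - \<eta> v(w\<^sub>1 \<dots> w\<^sub>n))\<close>, so every term is affine in \<open>\<eta>\<close> up to the normalisation by \<open>\<eta>\<close>, and
  collecting terms yields \<open>c / \<eta> + K\<close>, which is monotone in \<open>\<eta>\<close>.
\<close>

section \<open>Distance to the nearest integer\<close>

definition int_dist :: "real \<Rightarrow> real" where
  "int_dist s = \<bar>s - of_int (round s)\<bar>"

lemma int_dist_le: "int_dist s \<le> \<bar>s - of_int k\<bar>"
  unfolding int_dist_def by (rule round_diff_minimal)

lemma int_dist_nonneg: "0 \<le> int_dist s"
  by (simp add: int_dist_def)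

lemma int_dist_eqI:
  assumes "\<And>k. \<exists>j. \<bar>t - of_int j\<bar> \<le> \<bar>s - of_int k\<bar>"
    and "\<And>k. \<exists>j. \<bar>s - of_int j\<bar> \<le> \<bar>t - of_int k\<bar>"
  shows "int_dist s = int_dist t"
proof (rule antisym)
  show "int_dist s \<le> int_dist t"
    using assms(2)[of "round t"] int_dist_le[of s] by (metis int_dist_def order_trans)
  show "int_dist t \<le> int_dist s"
    using assms(1)[of "round s"] int_dist_le[of t] by (metis int_dist_def order_trans)
qed

lemma int_dist_minus: "int_dist (- s) = int_dist s"
proof (rule int_dist_eqI)
  fix k :: int
  have "\<bar>s - of_int (-k)\<bar> \<le> \<bar>- s - of_int k\<bar>" by simp
  then show "\<exists>j. \<bar>s - of_int j\<bar> \<le> \<bar>- s - of_int k\<bar>" by blast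
  have "\<bar>- s - of_int (-k)\<bar> \<le> \<bar>s - of_int k\<bar>" by simp
  then show "\<exists>j. \<bar>- s - of_int j\<bar> \<le> \<bar>s - of_int k\<bar>" by blast
qed

lemma int_dist_add_int: "int_dist (s + of_int z) = int_dist s"
proof (rule int_dist_eqI)
  fix k :: int
  have "\<bar>s - of_int (k - z)\<bar> \<le> \<bar>s + of_int z - of_int k\<bar>" by simp
  then show "\<exists>j. \<bar>s - of_int j\<bar> \<le> \<bar>s + of_int z - of_int k\<bar>" by blast
  have "\<bar>s + of_int z - of_int (k + z)\<bar> \<le> \<bar>s - of_int k\<bar>" by simp
  then show "\<exists>j. \<bar>s + of_int z - of_int j\<bar> \<le> \<bar>s - of_int k\<bar>" by blast
qed

lemma int_dist_unit:
  assumes "0 \<le> s" "s \<le> 1"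
  shows "int_dist s = min s (1 - s)"
proof (rule antisym)
  show "int_dist s \<le> min s (1 - s)"
    using int_dist_le[of s 0] int_dist_le[of s 1] assms by simp
  have "round s \<le> 0 \<or> round s \<ge> 1" by linarith
  then have "real_of_int (round s) \<le> 0 \<or> real_of_int (round s) \<ge> 1" by simp
  then show "min s (1 - s) \<le> int_dist s"
    using assms unfolding int_dist_def by (auto simp: min_def)
qed

lemma int_dist_lipschitz: "\<bar>int_dist s - int_dist t\<bar> \<le> \<bar>s - t\<bar>"
  using int_dist_le[of s "round t"] int_dist_le[of t "round s"]
  unfolding int_dist_def by linarith

lemma continuous_on_int_dist [continuous_intros]:
  "continuous_on S f \<Longrightarrow> continuous_on S (\<lambda>x. int_dist (f x))"
proof (rule continuous_on_compose2[of UNIV int_dist])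
  show "continuous_on UNIV int_dist"
    unfolding continuous_on_iff dist_real_def
    using int_dist_lipschitz by (meson order_le_less_trans)
qed auto

lemma borel_measurable_int_dist [measurable]: "int_dist \<in> borel_measurable borel"
  by (intro borel_measurable_continuous_onI continuous_intros continuous_on_id)

section \<open>Pairs of points at distance \<open>\<eta>\<close>\<close>
lemma sym_doubling_cong: "\<exists>k::int. (sym_doubling \<eta> ^^ n) x = 2 ^ n * x - of_int k * \<eta>"
proof (induction n)
  case 0
  show ?case by (rule exI[of _ 0]) simp
next
  case (Suc n)
  then obtain k where k: "(sym_doubling \<eta> ^^ n) x = 2 ^ n * x - of_int k * \<eta>" by blast
  let ?d = "first_digit ((sym_doubling \<eta> ^^ n) x)"
  have "(sym_doubling \<eta> ^^ Suc n) x = 2 ^ Suc n * x - of_int (2 * k + ?d) * \<eta>"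
    using k by (simp add: sym_doubling_def algebra_simps)
  then show ?case by blast
qed

lemma int_dist_orbit:
  assumes "\<eta> > 0"
  shows "int_dist ((sym_doubling \<eta> ^^ n) x / \<eta>) = int_dist (2 ^ n * x / \<eta>)"
proof -
  obtain k :: int where k: "(sym_doubling \<eta> ^^ n) x = 2 ^ n * x - of_int k * \<eta>"
    using sym_doubling_cong by blast
  have "(sym_doubling \<eta> ^^ n) x / \<eta> = 2 ^ n * x / \<eta> + of_int (- k)"
    using assms k by (simp add: field_simps)
  then show ?thesis using int_dist_add_int by metis
qed

text \<open>
  For \<open>\<eta> > 1\<close> and \<open>x \<in> [\<eta> - 1, 1]\<close> this says that the orbits of \<open>x\<close> and \<open>x - \<eta>\<close> have not merged within the first \<open>n\<close> steps.
  It is phrased through the doubling map of the circle alone, which makes its dependence on \<open>x\<close> and on \<open>\<eta>\<close>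
  explicit.
\<close>
definition survives :: "real \<Rightarrow> real \<Rightarrow> nat \<Rightarrow> bool" where
  "survives \<eta> x n \<longleftrightarrow> (\<forall>j<n. int_dist (2 ^ j * x / \<eta>) \<le> 1 / (2 * \<eta>))"

text \<open>
  The condition for surviving one step, translated from the circle back to the interval: the forbidden zone is the
  gap between the branch \<open>x \<mapsto> 2 x\<close> and the branch \<open>x \<mapsto> 2 x - \<eta>\<close>.
\<close>
lemma int_dist_gap:
  assumes "1 \<le> \<eta>" "\<eta> - 1 \<le> x" "x \<le> 1"
  shows "int_dist (x / \<eta>) = min x (\<eta> - x) / \<eta>"
    and "int_dist (x / \<eta>) \<le> 1 / (2 * \<eta>) \<longleftrightarrow> x \<le> 1/2 \<or> \<eta> - 1/2 \<le> x"
proof -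
  show *: "int_dist (x / \<eta>) = min x (\<eta> - x) / \<eta>"
    using assms by (subst int_dist_unit) (auto simp: min_def field_simps)
  show "int_dist (x / \<eta>) \<le> 1 / (2 * \<eta>) \<longleftrightarrow> x \<le> 1/2 \<or> \<eta> - 1/2 \<le> x"
    unfolding * using assms by (auto simp: field_simps min_def split: if_splits)
qed

text \<open>
  The pair \<open>(x, x - \<eta>)\<close> has digits \<open>(0, -1)\<close>, \<open>(1, 0)\<close> or \<open>(1, -1)\<close>. A difference of one between the digits
  restores the distance \<open>\<eta>\<close> after doubling, a difference of two annihilates it.
\<close>
lemma pair_step:
  assumes "1 < \<eta>" "\<eta> - 1 \<le> x" "x \<le> 1"
  shows "x \<le> 1/2 \<Longrightarrow> sym_doubling \<eta> x = 2 * x \<and> sym_doubling \<eta> (x - \<eta>) = 2 * x - \<eta>"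
    and "\<eta> - 1/2 \<le> x \<Longrightarrow> sym_doubling \<eta> x = 2 * x - \<eta> \<and> sym_doubling \<eta> (x - \<eta>) = 2 * x - 2 * \<eta>"
    and "1/2 < x \<Longrightarrow> x < \<eta> - 1/2 \<Longrightarrow> sym_doubling \<eta> x = sym_doubling \<eta> (x - \<eta>)"
  using assms by (auto simp: sym_doubling_def first_digit_def)

lemma pair_orbit:
  assumes "1 < \<eta>" "\<eta> - 1 \<le> x" "x \<le> 1" "survives \<eta> x n"
  shows "(sym_doubling \<eta> ^^ n) x \<in> {\<eta> - 1..1}
       \<and> (sym_doubling \<eta> ^^ n) (x - \<eta>) = (sym_doubling \<eta> ^^ n) x - \<eta>"
  using \<open>survives \<eta> x n\<close>
proof (induction n)
  case 0
  then show ?case using assms by simp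
next
  case (Suc n)
  let ?t = "(sym_doubling \<eta> ^^ n) x"
  have IH: "?t \<in> {\<eta> - 1..1}" "(sym_doubling \<eta> ^^ n) (x - \<eta>) = ?t - \<eta>"
    using Suc by (auto simp: survives_def)
  have "int_dist (?t / \<eta>) \<le> 1 / (2 * \<eta>)"
    using Suc.prems assms int_dist_orbit[of \<eta> n x] by (simp add: survives_def)
  then have "?t \<le> 1/2 \<or> \<eta> - 1/2 \<le> ?t"
    using int_dist_gap(2)[of \<eta> ?t] IH assms by simp
  then show ?case
    using pair_step(1,2)[of \<eta> ?t] IH assms by auto
qed

lemma pair_merges:
  assumes "1 < \<eta>" "\<eta> - 1 \<le> x" "x \<le> 1" "\<not> survives \<eta> x n"
  shows "(sym_doubling \<eta> ^^ n) (x - \<eta>) = (sym_doubling \<eta> ^^ n) x"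
  using \<open>\<not> survives \<eta> x n\<close>
proof (induction n)
  case 0
  then show ?case by (simp add: survives_def)
next
  case (Suc n)
  let ?t = "(sym_doubling \<eta> ^^ n) x"
  show ?case
  proof (cases "survives \<eta> x n")
    case False
    then show ?thesis using Suc.IH by simp
  next
    case True
    have *: "?t \<in> {\<eta> - 1..1}" "(sym_doubling \<eta> ^^ n) (x - \<eta>) = ?t - \<eta>"
      using pair_orbit[OF assms(1-3) True] by auto
    have "\<not> int_dist (?t / \<eta>) \<le> 1 / (2 * \<eta>)"
      using Suc.prems True assms int_dist_orbit[of \<eta> n x] by (auto simp: survives_def less_Suc_eq)
    then have "1/2 < ?t" "?t < \<eta> - 1/2"
      using int_dist_gap(2)[of \<eta> ?t] * assms by auto
    then show ?thesis
      using pair_step(3)[of \<eta> ?t] * assms by auto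
  qed
qed

abbreviation orbit_one :: "real \<Rightarrow> nat \<Rightarrow> real" where
  "orbit_one \<eta> n \<equiv> (sym_doubling \<eta> ^^ n) 1"
lemma orbit_one_mem:
  assumes "1 \<le> \<eta>" "\<eta> \<le> 2" "survives \<eta> 1 n"
  shows "orbit_one \<eta> n \<in> {\<eta> - 1..1}"
proof (cases "\<eta> = 1")
  case True
  have "(sym_doubling 1 ^^ n) 1 = 1" by (induction n) (auto simp: sym_doubling_def first_digit_def)
  with True show ?thesis by simp
next
  case False
  then show ?thesis using pair_orbit[of \<eta> 1 n] assms by simp
qed

lemma matching_index_one: "matching_index 1 = \<infinity>"
proof -
  have "(sym_doubling 1 ^^ n) 1 = 1" "(sym_doubling 1 ^^ n) 0 = 0" for n
    by (induction n) (auto simp: sym_doubling_def first_digit_def)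
  then show ?thesis by (simp add: matching_index_def top_enat_def)
qed

text \<open>
  The parameter \<open>\<eta> = 1\<close> is excluded by finiteness of the matching index: there \<open>1\<close> and \<open>1 - \<eta> = 0\<close> are both
  fixed points.
\<close>
lemma survives_iff_less_matching_index:
  assumes "1 \<le> \<eta>" "\<eta> \<le> 2" "matching_index \<eta> = enat m"
  shows "1 < \<eta>" "1 \<le> m" "survives \<eta> 1 n \<longleftrightarrow> n < m"
proof -
  show \<eta>: "1 < \<eta>" using assms matching_index_one by (cases "\<eta> = 1") auto
  let ?M = "{m. 1 \<le> m \<and> (sym_doubling \<eta> ^^ m) 1 = (sym_doubling \<eta> ^^ m) (1 - \<eta>)}"
  have im: "matching_index \<eta> = Inf (enat ` ?M)"
    unfolding matching_index_def by (rule arg_cong[of _ _ Inf]) auto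
  have "?M \<noteq> {}"
  proof
    assume "?M = {}"
    then have "matching_index \<eta> = \<infinity>" unfolding im by (simp only: image_empty Inf_empty top_enat_def)
    with assms show False by simp
  qed
  then have "Inf (enat ` ?M) \<in> enat ` ?M"
    by (meson wellorder_InfI ex_in_conv image_is_empty)
  then have m: "m \<in> ?M" unfolding im[symmetric] assms by auto
  have least: "m \<le> k" if "k \<in> ?M" for k
    using Inf_lower[of "enat k" "enat ` ?M"] that unfolding im[symmetric] assms by simp
  show "1 \<le> m" using m by simp
  have sv: "survives \<eta> 1 k \<longleftrightarrow> (sym_doubling \<eta> ^^ k) 1 \<noteq> (sym_doubling \<eta> ^^ k) (1 - \<eta>)" for k
    using pair_orbit[of \<eta> 1 k] pair_merges[of \<eta> 1 k] \<eta> assms by (cases "survives \<eta> 1 k") auto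
  show "survives \<eta> 1 n \<longleftrightarrow> n < m"
  proof
    assume "survives \<eta> 1 n"
    then have "\<not> m \<le> n" using sv[of m] m by (auto simp: survives_def)
    then show "n < m" by simp
  next
    assume "n < m"
    show "survives \<eta> 1 n"
    proof (cases "n = 0")
      case False
      then show ?thesis using sv[of n] least[of n] \<open>n < m\<close> by auto
    qed (simp add: survives_def)
  qed
qed


section \<open>Equidistribution of doubled periodic sets\<close>
lemma measure_lborel_affine:
  fixes c t :: real
  assumes [measurable]: "A \<in> sets borel" and "c > 0"
  shows "measure lborel {x. c * x + t \<in> A} = measure lborel A / c"
proof -
  have "emeasure lborel A = emeasure (density (distr lborel borel (\<lambda>x. t + c * x)) (\<lambda>_. ennreal \<bar>c\<bar>)) A"
    using lborel_real_affine[of c t] assms by simp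
  also have "\<dots> = ennreal c * emeasure lborel {x. c * x + t \<in> A}"
    using assms by (simp add: emeasure_density nn_integral_cmult emeasure_distr vimage_def add.commute)
  finally have "emeasure lborel A = ennreal c * emeasure lborel {x. c * x + t \<in> A}" .
  then have "measure lborel A = c * measure lborel {x. c * x + t \<in> A}"
    using assms by (simp add: measure_def enn2real_mult)
  then show ?thesis using assms by simp
qed

lemma fmeasurable_Int_interval:
  fixes a b :: real
  assumes [measurable]: "A \<in> sets borel"
  shows "A \<inter> {a<..b} \<in> fmeasurable lborel"
proof (rule fmeasurableI)
  have "emeasure lborel (A \<inter> {a<..b}) \<le> emeasure lborel {min a b..b}"
    by (rule emeasure_mono) auto
  also have "\<dots> < \<infinity>" by simp
  finally show "emeasure lborel (A \<inter> {a<..b}) < \<infinity>" .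
qed simp

locale periodic_set =
  fixes \<eta> :: real and P :: "real set"
  assumes period_pos: "\<eta> > 0"
    and borel_P [measurable]: "P \<in> sets borel"
    and shift: "x + \<eta> \<in> P \<longleftrightarrow> x \<in> P"
begin

definition mean :: real where
  "mean = measure lborel (P \<inter> {0<..\<eta>}) / \<eta>"

lemma mean_nonneg: "0 \<le> mean"
  using period_pos by (simp add: mean_def)

lemma shift_nat: "x + of_nat n * \<eta> \<in> P \<longleftrightarrow> x \<in> P"
proof (induction n)
  case (Suc n)
  have "x + of_nat (Suc n) * \<eta> = (x + of_nat n * \<eta>) + \<eta>" by (simp add: algebra_simps)
  with Suc shift show ?case by metis
qed simp

lemma shift_int: "x + of_int z * \<eta> \<in> P \<longleftrightarrow> x \<in> P"
proof (cases z)
  case (nonneg n)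
  then show ?thesis using shift_nat[of x n] by simp
next
  case (neg n)
  then have "real_of_int z = - of_nat (Suc n)" by simp
  then have "x + of_int z * \<eta> + of_nat (Suc n) * \<eta> = x"
    by (simp only: mult_minus_left add.assoc left_minus add_0_right)
  then show ?thesis using shift_nat[of "x + of_int z * \<eta>" "Suc n"] by metis
qed

lemma measure_one_period:
  "measure lborel (P \<inter> {of_int z * \<eta><..(of_int z + 1) * \<eta>}) = mean * \<eta>"
proof -
  have "{x. 1 * x + of_int z * \<eta> \<in> P \<inter> {of_int z * \<eta><..(of_int z + 1) * \<eta>}} = P \<inter> {0<..\<eta>}"
    using shift_int[of _ z] by (auto simp: algebra_simps)
  then show ?thesis
    using measure_lborel_affine[of "P \<inter> {of_int z * \<eta><..(of_int z + 1) * \<eta>}" 1 "of_int z * \<eta>"]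
      period_pos by (simp add: mean_def)
qed

lemma measure_periods:
  "measure lborel (P \<inter> {of_int z * \<eta><..(of_int z + of_nat k) * \<eta>}) = of_nat k * mean * \<eta>"
proof (induction k)
  case (Suc k)
  let ?I = "{of_int z * \<eta><..(of_int z + of_nat k) * \<eta>}"
  let ?J = "{of_int (z + int k) * \<eta><..(of_int (z + int k) + 1) * \<eta>}"
  have "of_int z * \<eta> \<le> (of_int z + of_nat k) * \<eta>"
    "(of_int z + of_nat k) * \<eta> \<le> (of_int z + of_nat k + 1) * \<eta>"
    using period_pos by (auto intro!: mult_right_mono)
  then have *: "P \<inter> {of_int z * \<eta><..(of_int z + of_nat (Suc k)) * \<eta>} = (P \<inter> ?I) \<union> (P \<inter> ?J)"
    by (auto simp: add.assoc add.commute[of 1])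
  have "measure lborel ((P \<inter> ?I) \<union> (P \<inter> ?J)) = measure lborel (P \<inter> ?I) + measure lborel (P \<inter> ?J)"
    using fmeasurable_Int_interval[OF borel_P, THEN fmeasurableD2] by (intro measure_Union) auto
  then show ?case
    unfolding * using Suc measure_one_period[of "z + int k"] by (simp add: algebra_simps)
qed simp

text \<open>
  Comparing with the whole periods inside and around the interval leaves an error of at most one period. The bound does
  not grow with the length of the interval, so rescaling by \<open>2\<^sup>-\<^sup>n\<close> makes it vanish.
\<close>
lemma measure_interval_close:
  assumes "of_int z * \<eta> \<le> b"
  shows "\<bar>measure lborel (P \<inter> {of_int z * \<eta><..b}) - mean * (b - of_int z * \<eta>)\<bar> \<le> mean * \<eta>"
proof -
  define k where "k = nat \<lfloor>b / \<eta> - of_int z\<rfloor>"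
  have "0 \<le> b / \<eta> - of_int z" using assms period_pos by (simp add: field_simps)
  then have "real k \<le> b / \<eta> - of_int z" "b / \<eta> - of_int z \<le> real k + 1"
    unfolding k_def by linarith+
  then have k: "(of_int z + of_nat k) * \<eta> \<le> b" "b \<le> (of_int z + of_nat (Suc k)) * \<eta>"
    using period_pos by (simp_all add: field_simps)
  have "measure lborel (P \<inter> {of_int z * \<eta><..(of_int z + of_nat k) * \<eta>})
      \<le> measure lborel (P \<inter> {of_int z * \<eta><..b})"
    using k by (intro measure_mono_fmeasurable fmeasurable_Int_interval) auto
  then have 1: "of_nat k * mean * \<eta> \<le> measure lborel (P \<inter> {of_int z * \<eta><..b})"
    by (simp add: measure_periods)
  have "measure lborel (P \<inter> {of_int z * \<eta><..b})
      \<le> measure lborel (P \<inter> {of_int z * \<eta><..(of_int z + of_nat (Suc k)) * \<eta>})"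
    using k by (intro measure_mono_fmeasurable fmeasurable_Int_interval) auto
  then have 2: "measure lborel (P \<inter> {of_int z * \<eta><..b}) \<le> of_nat (Suc k) * mean * \<eta>"
    by (simp only: measure_periods)
  have 3: "mean * (of_nat k * \<eta>) \<le> mean * (b - of_int z * \<eta>)"
    "mean * (b - of_int z * \<eta>) \<le> mean * (of_nat (Suc k) * \<eta>)"
    using k mean_nonneg by (intro mult_left_mono; simp add: algebra_simps)+
  show ?thesis using 1 2 3 by (simp add: algebra_simps abs_le_iff)
qed

definition scaled :: "nat \<Rightarrow> real set" where
  "scaled n = {x. 2 ^ n * x \<in> P}"

lemma scaled_measurable [measurable]: "scaled n \<in> sets borel"
  unfolding scaled_def by measurable

text \<open>
  The left end \<open>- \<eta>\<close> is scaled to a multiple of the period, where \<open>measure_interval_close\<close> applies.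
\<close>
lemma equidistribution_interval:
  assumes "-\<eta> \<le> b"
  shows "(\<lambda>n. measure lborel (scaled n \<inter> {-\<eta><..b})) \<longlonglongrightarrow> mean * (b + \<eta>)"
proof -
  have "\<bar>measure lborel (scaled n \<inter> {-\<eta><..b}) - mean * (b + \<eta>)\<bar> \<le> mean * \<eta> * (1/2) ^ n" for n
  proof -
    let ?z = "- (2 ^ n) :: int"
    have "scaled n \<inter> {-\<eta><..b} = {x. 2 ^ n * x + 0 \<in> P \<inter> {of_int ?z * \<eta><..2 ^ n * b}}"
      by (auto simp: scaled_def mult_less_cancel_left_pos[of "2^n" "-\<eta>", simplified])
    then have eq: "measure lborel (scaled n \<inter> {-\<eta><..b})
        = measure lborel (P \<inter> {of_int ?z * \<eta><..2 ^ n * b}) / 2 ^ n"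
      using measure_lborel_affine[of "P \<inter> {of_int ?z * \<eta><..2 ^ n * b}" "2 ^ n" 0] by simp
    have "2 ^ n * (-\<eta>) \<le> 2 ^ n * b" by (rule mult_left_mono) (use assms in auto)
    then have "of_int ?z * \<eta> \<le> 2 ^ n * b" by simp
    from measure_interval_close[OF this]
    have "\<bar>measure lborel (P \<inter> {of_int ?z * \<eta><..2 ^ n * b}) - mean * (2 ^ n * (b + \<eta>))\<bar> \<le> mean * \<eta>"
      by (simp add: algebra_simps)
    then have "\<bar>measure lborel (P \<inter> {of_int ?z * \<eta><..2 ^ n * b}) - mean * (2 ^ n * (b + \<eta>))\<bar> / 2 ^ n
        \<le> mean * \<eta> / 2 ^ n"
      by (rule divide_right_mono) simp
    also have "\<bar>measure lborel (P \<inter> {of_int ?z * \<eta><..2 ^ n * b}) - mean * (2 ^ n * (b + \<eta>))\<bar> / 2 ^ n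
       = \<bar>(measure lborel (P \<inter> {of_int ?z * \<eta><..2 ^ n * b}) - mean * (2 ^ n * (b + \<eta>))) / 2 ^ n\<bar>"
      by simp
    also have "\<dots> = \<bar>measure lborel (scaled n \<inter> {-\<eta><..b}) - mean * (b + \<eta>)\<bar>"
      unfolding eq by (simp add: field_simps)
    finally show ?thesis by (simp add: power_one_over field_simps)
  qed
  then have "\<forall>\<^sub>F n in sequentially. norm (measure lborel (scaled n \<inter> {-\<eta><..b}) - mean * (b + \<eta>)) \<le> mean * \<eta> * (1/2) ^ n"
    by simp
  moreover have "(\<lambda>n. mean * \<eta> * (1/2) ^ n) \<longlonglongrightarrow> 0"
    by (rule tendsto_mult_right_zero) (rule LIMSEQ_power_zero, simp)
  ultimately have "(\<lambda>n. measure lborel (scaled n \<inter> {-\<eta><..b}) - mean * (b + \<eta>)) \<longlonglongrightarrow> 0"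
    by (rule Lim_null_comparison)
  then show ?thesis by (simp add: LIM_zero_iff)
qed

text \<open>
  By Dynkin's lemma, convergence passes from half-lines to all Borel sets. A countable disjoint union is handled by
  Tannery's theorem: the terms are dominated by the measures of the pieces.
\<close>
lemma equidistribution_set:
  assumes "B \<in> sets borel"
  shows "(\<lambda>n. measure lborel (B \<inter> (scaled n \<inter> {-\<eta><..\<eta>}))) \<longlonglongrightarrow> mean * measure lborel (B \<inter> {-\<eta><..\<eta>})"
proof -
  let ?I = "{-\<eta><..\<eta>}"
  have S: "(sets borel :: real set set) = sigma_sets UNIV (range (\<lambda>a. {..a}))"
    by (subst borel_eq_atMost) simp
  have "Int_stable (range (\<lambda>a::real. {..a}))"
    by (auto simp: Int_stable_def)
  moreover have "range (\<lambda>a::real. {..a}) \<subseteq> Pow UNIV" by auto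
  moreover have "B \<in> sigma_sets UNIV (range (\<lambda>a. {..a}))"
    using assms S by simp
  ultimately show ?thesis
  proof (induction rule: sigma_sets_induct_disjoint)
    case (basic A)
    then obtain a where A: "A = {..a}" by auto
    show ?case
    proof (cases "-\<eta> \<le> a")
      case True
      have *: "A \<inter> (X \<inter> ?I) = X \<inter> {-\<eta><..min a \<eta>}" for X by (auto simp: A)
      have "A \<inter> ?I = {-\<eta><..min a \<eta>}" by (auto simp: A)
      then show ?thesis
        unfolding * using equidistribution_interval[of "min a \<eta>"] True period_pos
        by simp
    next
      case False
      then have "A \<inter> ?I = {}" "\<And>X. A \<inter> (X \<inter> ?I) = {}" by (auto simp: A)
      then show ?thesis by simp
    qed
  next
    case empty
    show ?case by simp
  next
    case (compl A)
    then have [measurable]: "A \<in> sets borel" by (simp add: S)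
    have d: "measure lborel ((UNIV - A) \<inter> (X \<inter> ?I)) = measure lborel (X \<inter> ?I) - measure lborel (A \<inter> (X \<inter> ?I))"
      if [measurable]: "X \<in> sets borel" for X
    proof -
      have "(UNIV - A) \<inter> (X \<inter> ?I) = (X \<inter> ?I) - (A \<inter> (X \<inter> ?I))" by auto
      moreover have "A \<inter> (X \<inter> ?I) \<in> fmeasurable lborel"
        using fmeasurable_Int_interval[of "A \<inter> X"] by (simp add: Int_assoc)
      ultimately show ?thesis
        using measurable_measure_Diff[of "X \<inter> ?I" lborel "A \<inter> (X \<inter> ?I)"]
          fmeasurable_Int_interval[of X] by (auto simp: fmeasurable_def)
    qed
    have "(\<lambda>n. measure lborel (scaled n \<inter> ?I) - measure lborel (A \<inter> (scaled n \<inter> ?I)))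
        \<longlonglongrightarrow> mean * measure lborel ?I - mean * measure lborel (A \<inter> ?I)"
      using equidistribution_interval[of \<eta>] period_pos compl by (intro tendsto_diff) auto
    then show ?case
      using d[of UNIV] d[of "scaled _"] by (simp add: right_diff_distrib)
  next
    case (union A)
    then have [measurable]: "A i \<in> sets borel" for i by (auto simp: S)
    have dj: "disjoint_family (\<lambda>i. A i \<inter> X)" for X
      using union.hyps by (auto simp: disjoint_family_on_def)
    have fm: "A i \<inter> (X \<inter> ?I) \<in> fmeasurable lborel" if [measurable]: "X \<in> sets borel" for i X
      using fmeasurable_Int_interval[of "A i \<inter> X"] by (simp add: Int_assoc)
    have sums: "(\<lambda>i. measure lborel (A i \<inter> (X \<inter> ?I))) sums measure lborel ((\<Union>i. A i) \<inter> (X \<inter> ?I))"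
      if [measurable]: "X \<in> sets borel" for X
    proof -
      have "emeasure lborel (\<Union>i. A i \<inter> (X \<inter> ?I)) \<le> emeasure lborel ?I"
        by (rule emeasure_mono) auto
      also have "\<dots> < \<infinity>" using period_pos by (subst emeasure_lborel_Ioc) auto
      finally have "emeasure lborel (\<Union>i. A i \<inter> (X \<inter> ?I)) \<noteq> \<infinity>" by simp
      then have "(\<lambda>i. measure lborel (A i \<inter> (X \<inter> ?I))) sums measure lborel (\<Union>i. A i \<inter> (X \<inter> ?I))"
        using dj[of "X \<inter> ?I"] by (intro measure_UNION) auto
      then show ?thesis by (simp add: Int_UN_distrib2)
    qed
    have "(\<lambda>n. \<Sum>i. measure lborel (A i \<inter> (scaled n \<inter> ?I))) \<longlonglongrightarrow> (\<Sum>i. mean * measure lborel (A i \<inter> ?I))"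
    proof (rule tannerys_theorem[THEN conjunct2, THEN conjunct2])
      show "(\<lambda>n. measure lborel (A k \<inter> (scaled n \<inter> ?I))) \<longlonglongrightarrow> mean * measure lborel (A k \<inter> ?I)" for k
        by (rule union)
      show "summable (\<lambda>i. measure lborel (A i \<inter> (UNIV \<inter> ?I)))"
        using sums[of UNIV] by (auto simp: sums_iff)
      show "\<forall>\<^sub>F (k, n) in sequentially \<times>\<^sub>F sequentially.
          norm (measure lborel (A k \<inter> (scaled n \<inter> ?I))) \<le> measure lborel (A k \<inter> (UNIV \<inter> ?I))"
      proof (rule always_eventually, clarify)
        fix k n
        show "norm (measure lborel (A k \<inter> (scaled n \<inter> ?I))) \<le> measure lborel (A k \<inter> (UNIV \<inter> ?I))"
          using fm[of UNIV k] by (auto intro!: measure_mono_fmeasurable)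
      qed
    qed simp
    moreover have "(\<Sum>i. mean * measure lborel (A i \<inter> ?I)) = mean * measure lborel ((\<Union>i. A i) \<inter> ?I)"
      using sums_mult[OF sums[of UNIV], of mean] by (simp add: sums_iff)
    ultimately show ?case
      using sums[of "scaled _"] by (simp add: sums_iff)
  qed
qed

end


text \<open>
  A version of Fejer's lemma. The interval \<open>(-\<eta>, \<eta>]\<close> only has to be bounded and to contain \<open>[-1,1]\<close>, on which the
  densities considered below live.
\<close>
lemma (in periodic_set) equidistribution_integrable:
  fixes f :: "real \<Rightarrow> real"
  assumes "integrable lborel f"
  shows "(\<lambda>n. \<integral>x. f x * indicator (scaled n \<inter> {-\<eta><..\<eta>}) x \<partial>lborel)
     \<longlonglongrightarrow> mean * (\<integral>x. f x * indicator {-\<eta><..\<eta>} x \<partial>lborel)"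
  using assms
proof (induction rule: integrable_induct)
  case (base A c)
  have *: "(\<integral>x. (indicator A x *\<^sub>R c) * indicator X x \<partial>lborel) = c * measure lborel (A \<inter> X)"
    if [measurable]: "X \<in> sets borel" for X :: "real set"
  proof -
    have "(\<lambda>x. (indicator A x *\<^sub>R c) * indicator X x) = (\<lambda>x. c * (indicator (A \<inter> X) x :: real))"
      by (auto simp: fun_eq_iff indicator_def)
    then show ?thesis by simp
  qed
  have "(\<lambda>n. c * measure lborel (A \<inter> (scaled n \<inter> {-\<eta><..\<eta>})))
      \<longlonglongrightarrow> c * (mean * measure lborel (A \<inter> {-\<eta><..\<eta>}))"
    using base by (intro tendsto_mult_left equidistribution_set) simp
  then show ?case using *[of "scaled _ \<inter> _"] *[of "{-\<eta><..\<eta>}"] by (simp add: mult.left_commute)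
next
  case (add f g)
  have int: "integrable lborel (\<lambda>x. h x * indicator X x)" if "integrable lborel h" "X \<in> sets borel"
    for h :: "real \<Rightarrow> real" and X :: "real set"
    using integrable_mult_indicator[of X lborel h] that by (simp add: mult.commute)
  show ?case
    using tendsto_add[OF add.IH] add.hyps
    by (simp add: distrib_right Bochner_Integration.integral_add int distrib_left)
next
  case (lim f s)
  let ?I = "{-\<eta><..\<eta>}"
  have int: "integrable lborel (\<lambda>x. h x * indicator X x)" if "integrable lborel h" "X \<in> sets borel"
    for h :: "real \<Rightarrow> real" and X :: "real set"
    using integrable_mult_indicator[of X lborel h] that by (simp add: mult.commute)
  have "(\<lambda>i. \<integral>x. \<bar>s i x - f x\<bar> \<partial>lborel) \<longlonglongrightarrow> (\<integral>x. 0 \<partial>(lborel :: real measure))"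
  proof (rule integral_dominated_convergence)
    show "integrable lborel (\<lambda>x. 3 * \<bar>f x\<bar>)" using lim.hyps by auto
    show "AE x in lborel. (\<lambda>i. \<bar>s i x - f x\<bar>) \<longlonglongrightarrow> 0"
      using lim.hyps by (auto intro!: AE_I2 tendsto_rabs_zero simp: LIM_zero_iff)
    show "AE x in lborel. norm \<bar>s i x - f x\<bar> \<le> 3 * \<bar>f x\<bar>" for i
    proof (rule AE_I2)
      fix x :: real
      have "norm (s i x) \<le> 2 * norm (f x)" using lim.hyps by simp
      then show "norm \<bar>s i x - f x\<bar> \<le> 3 * \<bar>f x\<bar>" by simp
    qed
  qed (use lim.hyps in measurable)
  then have small: "(\<lambda>i. \<integral>x. \<bar>s i x - f x\<bar> \<partial>lborel) \<longlonglongrightarrow> 0" by simp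
  have close: "\<bar>(\<integral>x. s i x * indicator X x \<partial>lborel) - (\<integral>x. f x * indicator X x \<partial>lborel)\<bar>
      \<le> (\<integral>x. \<bar>s i x - f x\<bar> \<partial>lborel)" if "X \<in> sets borel" for i X
  proof -
    have "(\<integral>x. s i x * indicator X x \<partial>lborel) - (\<integral>x. f x * indicator X x \<partial>lborel)
       = (\<integral>x. (s i x - f x) * indicator X x \<partial>lborel)"
      using int[OF lim.hyps(1) that] int[OF lim.hyps(4) that] by (simp add: left_diff_distrib)
    also have "\<bar>\<dots>\<bar> \<le> (\<integral>x. \<bar>(s i x - f x) * indicator X x\<bar> \<partial>lborel)"
      by (rule integral_abs_bound)
    also have "\<dots> \<le> (\<integral>x. \<bar>s i x - f x\<bar> \<partial>lborel)"
      using lim.hyps that by (intro integral_mono int integrable_abs) (auto simp: indicator_def intro!: int)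
    finally show ?thesis .
  qed
  show ?case
  proof (rule LIMSEQ_I)
    fix e :: real assume "e > 0"
    then have "e / (2 * (1 + mean)) > 0" using mean_nonneg by simp
    then obtain i where i: "\<bar>\<integral>x. \<bar>s i x - f x\<bar> \<partial>lborel\<bar> < e / (2 * (1 + mean))"
      using LIMSEQ_D[OF small] by (metis diff_zero order_refl real_norm_def)
    let ?d = "\<integral>x. \<bar>s i x - f x\<bar> \<partial>lborel"
    have d: "(1 + mean) * ?d < e / 2"
      using i mean_nonneg by (simp add: field_simps)
    obtain n0 where n0: "\<And>n. n \<ge> n0 \<Longrightarrow>
       norm ((\<integral>x. s i x * indicator (scaled n \<inter> ?I) x \<partial>lborel) - mean * (\<integral>x. s i x * indicator ?I x \<partial>lborel)) < e / 2"
      using LIMSEQ_D[OF lim.IH, of "e / 2" i] \<open>e > 0\<close> by auto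
    show "\<exists>n0. \<forall>n\<ge>n0. norm ((\<integral>x. f x * indicator (scaled n \<inter> ?I) x \<partial>lborel) - mean * (\<integral>x. f x * indicator ?I x \<partial>lborel)) < e"
    proof (intro exI[of _ n0] allI impI)
      fix n assume "n \<ge> n0"
      have 1: "\<bar>(\<integral>x. s i x * indicator (scaled n \<inter> ?I) x \<partial>lborel) - (\<integral>x. f x * indicator (scaled n \<inter> ?I) x \<partial>lborel)\<bar> \<le> ?d"
        by (rule close) measurable
      have "\<bar>(\<integral>x. s i x * indicator ?I x \<partial>lborel) - (\<integral>x. f x * indicator ?I x \<partial>lborel)\<bar> \<le> ?d"
        by (rule close) measurable
      then have "mean * \<bar>(\<integral>x. s i x * indicator ?I x \<partial>lborel) - (\<integral>x. f x * indicator ?I x \<partial>lborel)\<bar> \<le> mean * ?d"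
        using mean_nonneg by (rule mult_left_mono)
      then have 2: "\<bar>mean * (\<integral>x. s i x * indicator ?I x \<partial>lborel) - mean * (\<integral>x. f x * indicator ?I x \<partial>lborel)\<bar> \<le> mean * ?d"
        using mean_nonneg by (simp add: abs_mult right_diff_distrib[symmetric])
      show "norm ((\<integral>x. f x * indicator (scaled n \<inter> ?I) x \<partial>lborel) - mean * (\<integral>x. f x * indicator ?I x \<partial>lborel)) < e"
        using 1 2 n0[OF \<open>n \<ge> n0\<close>] d unfolding real_norm_def distrib_right by linarith
    qed
  qed
qed

section \<open>Uniqueness of the absolutely continuous invariant probability\<close>
lemma sym_doubling_measurable [measurable]: "sym_doubling \<eta> \<in> borel_measurable borel"
  unfolding sym_doubling_def first_digit_def by measurable

lemma sym_doubling_iterate_measurable [measurable]: "sym_doubling \<eta> ^^ n \<in> borel_measurable borel"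
proof (induction n)
  case (Suc n)
  then show ?case
    using measurable_comp[OF Suc sym_doubling_measurable[of \<eta>]] by simp
qed (simp add: id_def)

lemma survives_measurable [measurable]: "Measurable.pred borel (\<lambda>x. survives \<eta> x n)"
  unfolding survives_def by measurable

text \<open>
  A surviving point never visits the periodic set \<open>P\<close> of positive mean density under doubling, while
  equidistribution makes every set of positive measure visit it.
\<close>
lemma null_survivors:
  assumes "1 < \<eta>"
  shows "{x \<in> {\<eta> - 1..1}. \<forall>n. survives \<eta> x n} \<in> null_sets lborel"
proof -
  \<comment> \<open>the gap \<open>(1/2, \<eta> - 1/2)\<close> between the branches, repeated periodically\<close>
  define P where "P = {x. int_dist (x / \<eta>) > 1 / (2 * \<eta>)}"
  interpret periodic_set \<eta> P
  proof
    show "P \<in> sets borel" unfolding P_def by measurable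
    fix x
    have "(x + \<eta>) / \<eta> = x / \<eta> + of_int 1" using assms by (simp add: field_simps)
    then have "int_dist ((x + \<eta>) / \<eta>) = int_dist (x / \<eta>)" using int_dist_add_int by metis
    then show "x + \<eta> \<in> P \<longleftrightarrow> x \<in> P" unfolding P_def by simp
  qed (use assms in simp)
  let ?E = "{x \<in> {\<eta> - 1..1}. \<forall>n. survives \<eta> x n}"
  have [measurable]: "?E \<in> sets borel" by measurable
  have "{1/2<..<\<eta> - 1/2} \<subseteq> P \<inter> {0<..\<eta>}"
  proof
    fix x assume x: "x \<in> {1/2<..<\<eta> - 1/2}"
    have "int_dist (x / \<eta>) = min x (\<eta> - x) / \<eta>"
      using x assms by (subst int_dist_unit) (auto simp: min_def field_simps)
    moreover have "1 / (2 * \<eta>) < min x (\<eta> - x) / \<eta>"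
      using x assms by (auto simp: field_simps min_def)
    ultimately show "x \<in> P \<inter> {0<..\<eta>}" using x assms by (auto simp: P_def)
  qed
  then have "measure lborel {1/2<..<\<eta> - 1/2} \<le> measure lborel (P \<inter> {0<..\<eta>})"
    by (intro measure_mono_fmeasurable fmeasurable_Int_interval) auto
  then have "mean > 0" using assms by (simp add: mean_def)
  have "?E \<inter> (scaled n \<inter> {-\<eta><..\<eta>}) = {}" for n
  proof -
    have "x \<notin> scaled n" if "survives \<eta> x (Suc n)" for x
    proof -
      have "int_dist (2 ^ n * x / \<eta>) \<le> 1 / (2 * \<eta>)" using that unfolding survives_def by blast
      then show ?thesis unfolding scaled_def by (simp add: P_def)
    qed
    then show ?thesis by blast
  qed
  then have "mean * measure lborel (?E \<inter> {-\<eta><..\<eta>}) = 0"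
    using equidistribution_set[of ?E] by (simp add: LIMSEQ_const_iff)
  moreover have EI: "?E \<inter> {-\<eta><..\<eta>} = ?E" using assms by auto
  ultimately have "measure lborel ?E = 0" using \<open>mean > 0\<close> by simp
  moreover have "emeasure lborel ?E \<noteq> \<infinity>"
    using fmeasurable_Int_interval[of ?E "-\<eta>" \<eta>, THEN fmeasurableD2] EI by simp
  ultimately have "emeasure lborel ?E = 0"
    using emeasure_eq_ennreal_measure[of lborel ?E] by simp
  then show ?thesis by (rule null_setsI) simp
qed

text \<open>
  Measures on \<open>[-1,1]\<close> are transported to \<open>\<real>\<close>, where periodic sets live.
\<close>
definition line_measure :: "real measure \<Rightarrow> real measure" where
  "line_measure M = distr M borel (\<lambda>x. x)"

lemma line_measure_properties:
  assumes "invariant_ac_prob \<eta> M"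
  shows "prob_space (line_measure M)" "sets (line_measure M) = sets borel"
    "absolutely_continuous lborel (line_measure M)"
    "distr (line_measure M) borel (sym_doubling \<eta>) = line_measure M"
    "measure (line_measure M) {-1..1} = 1"
    "\<And>A. A \<in> sets M \<Longrightarrow> A \<in> sets borel \<and> emeasure (line_measure M) A = emeasure M A"
proof -
  have M: "sets M = sets (restrict_space borel {-1..1})" "prob_space M"
     "absolutely_continuous (restrict_space lborel {-1..1}) M"
     "sym_doubling \<eta> \<in> measurable M M" "distr M M (sym_doubling \<eta>) = M"
    using assms by (auto simp: invariant_ac_prob_def)
  interpret prob_space M by fact
  have sp: "space M = {-1..1}" using sets_eq_imp_space_eq[OF M(1)] by (simp add: space_restrict_space)
  have id: "(\<lambda>x. x) \<in> measurable M borel"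
    using measurable_restrict_space1[of "\<lambda>x. x" borel borel "{-1..1}"]
    by (simp cong: measurable_cong_sets add: M(1))
  show "prob_space (line_measure M)" unfolding line_measure_def by (rule prob_space_distr[OF id])
  show [simp]: "sets (line_measure M) = sets borel" unfolding line_measure_def by simp
  have sM: "A \<in> sets M \<longleftrightarrow> A \<in> sets borel \<and> A \<subseteq> {-1..1}" for A
    unfolding M(1) by (subst sets_restrict_space_iff) auto
  have em: "emeasure (line_measure M) A = emeasure M (A \<inter> {-1..1})" if "A \<in> sets borel" for A
    unfolding line_measure_def using emeasure_distr[OF id that] by (simp add: sp)
  show "A \<in> sets borel \<and> emeasure (line_measure M) A = emeasure M A" if "A \<in> sets M" for A
    using em[of A] that sM[of A] by (auto simp: Int_absorb2)
  show "measure (line_measure M) {-1..1} = 1"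
    using em[of "{-1..1}"] prob_space by (simp add: measure_def sp)
  show "absolutely_continuous lborel (line_measure M)"
    unfolding absolutely_continuous_def
  proof
    fix A :: "real set" assume A: "A \<in> null_sets lborel"
    then have [measurable]: "A \<in> sets borel" by auto
    have "A \<inter> {-1..1} \<in> null_sets lborel" using A by (rule null_set_Int2) simp
    then have "A \<inter> {-1..1} \<in> null_sets (restrict_space lborel {-1..1})"
      by (subst null_sets_restrict_space) auto
    then have "A \<inter> {-1..1} \<in> null_sets M" using M(3) by (auto simp: absolutely_continuous_def)
    then show "A \<in> null_sets (line_measure M)" using em[of A] by (auto simp: null_sets_def)
  qed
  have "distr (line_measure M) borel (sym_doubling \<eta>) = distr M borel (\<lambda>x. sym_doubling \<eta> x)"
    unfolding line_measure_def using distr_distr[OF sym_doubling_measurable id] by (simp add: comp_def)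
  also have "\<dots> = distr (distr M M (sym_doubling \<eta>)) borel (\<lambda>x. x)"
    using distr_distr[OF id M(4)] by (simp add: comp_def)
  also have "\<dots> = line_measure M" unfolding M(5) line_measure_def ..
  finally show "distr (line_measure M) borel (sym_doubling \<eta>) = line_measure M" .
qed

lemma survivors_measure_tendsto_0:
  assumes "prob_space N" "sets N = sets borel" "absolutely_continuous lborel N" "1 < \<eta>"
  shows "(\<lambda>n. measure N {x \<in> {\<eta> - 1..1}. survives \<eta> x n}) \<longlonglongrightarrow> 0"
proof -
  interpret N: prob_space N by fact
  have "decseq (\<lambda>n. {x \<in> {\<eta> - 1..1}. survives \<eta> x n})"
    by (auto simp: decseq_def survives_def)
  moreover have "range (\<lambda>n. {x \<in> {\<eta> - 1..1}. survives \<eta> x n}) \<subseteq> sets N"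
    unfolding assms(2) by (intro image_subsetI) measurable
  ultimately have "(\<lambda>n. measure N {x \<in> {\<eta> - 1..1}. survives \<eta> x n})
      \<longlonglongrightarrow> measure N (\<Inter>n. {x \<in> {\<eta> - 1..1}. survives \<eta> x n})"
    by (intro N.finite_Lim_measure_decseq)
  also have "(\<Inter>n. {x \<in> {\<eta> - 1..1}. survives \<eta> x n}) = {x \<in> {\<eta> - 1..1}. \<forall>n. survives \<eta> x n}"
    by auto
  also have "measure N \<dots> = 0"
    using null_survivors[OF \<open>1 < \<eta>\<close>] assms(3) by (auto simp: absolutely_continuous_def measure_eq_0_null_sets)
  finally show ?thesis .
qed

lemma measure_iterate_preimage:
  assumes "sets N = sets borel" "distr N borel (sym_doubling \<eta>) = N" "A \<in> sets borel"
  shows "measure N {x. (sym_doubling \<eta> ^^ n) x \<in> A} = measure N A"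
  using \<open>A \<in> sets borel\<close>
proof (induction n arbitrary: A)
  case (Suc n)
  have sp: "space N = UNIV" using sets_eq_imp_space_eq[OF assms(1)] by simp
  have B: "{x. sym_doubling \<eta> x \<in> A} \<in> sets borel"
    using measurable_sets_borel[OF sym_doubling_measurable Suc.prems] by (simp add: vimage_def)
  have "measure N {x. (sym_doubling \<eta> ^^ Suc n) x \<in> A} = measure N {x. sym_doubling \<eta> x \<in> A}"
    using Suc.IH[OF B] by simp
  also have "\<dots> = measure (distr N borel (sym_doubling \<eta>)) A"
    using Suc.prems assms(1) by (subst measure_distr) (auto simp: sp vimage_def cong: measurable_cong_sets)
  finally show ?case using assms(2) by simp
qed simp

lemma real_density:
  assumes "prob_space N" "sets N = sets borel" "absolutely_continuous lborel N"
  obtains f :: "real \<Rightarrow> real" where "integrable lborel f"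
    "\<And>A. A \<in> sets borel \<Longrightarrow> measure N A = (\<integral>x. f x * indicator A x \<partial>lborel)"
proof -
  interpret N: prob_space N by fact
  have fin: "finite_measure N" by unfold_locales
  have sl: "sets N = sets lborel" using assms(2) by simp
  obtain D where D: "D \<in> borel_measurable lborel" "AE x in lborel. RN_deriv lborel N x = ennreal (D x)"
    "\<And>x. 0 \<le> D x"
    using sigma_finite_measure.real_RN_deriv[OF sigma_finite_lborel fin assms(3) sl] by blast
  have "N = density lborel (RN_deriv lborel N)"
    using sigma_finite_measure.density_RN_deriv[OF sigma_finite_lborel assms(3)] assms(2) by simp
  also have "\<dots> = density lborel (\<lambda>x. ennreal (D x))"
    using D by (intro density_cong) auto
  finally have N: "N = density lborel (\<lambda>x. ennreal (D x))" .
  have "integrable N (\<lambda>x. 1 :: real)" by simp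
  then have "integrable lborel (\<lambda>x. D x * 1)"
    unfolding N using D by (subst (asm) integrable_density) auto
  moreover have "measure N A = (\<integral>x. D x * indicator A x \<partial>lborel)" if [measurable]: "A \<in> sets borel" for A
  proof -
    have "measure N A = (\<integral>x. indicator A x \<partial>N)" using that assms(2) by simp
    also have "\<dots> = (\<integral>x. D x * indicator A x \<partial>lborel)"
      by (subst N, subst integral_density) (use D in auto)
    finally show ?thesis .
  qed
  ultimately show thesis using that[of D] by simp
qed

text \<open>
  The doubling map of the circle has only one absolutely continuous invariant probability. By invariance and periodicity,
  the measure of \<open>P\<close> equals that of its pull-back under \<open>x \<mapsto> 2\<^sup>n x\<close> for every \<open>n\<close>, and by equidistribution those
  measures converge to the mean density.
\<close>
lemma measure_periodic_set:
  assumes N: "prob_space N" "sets N = sets borel" "absolutely_continuous lborel N"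
    "measure N {-1..1} = 1" "distr N borel (sym_doubling \<eta>) = N" and \<eta>: "1 < \<eta>"
    and "periodic_set \<eta> P"
  shows "measure N P = periodic_set.mean \<eta> P"
proof -
  interpret N: prob_space N by fact
  interpret periodic_set \<eta> P by fact
  obtain f :: "real \<Rightarrow> real" where f: "integrable lborel f"
    "\<And>A. A \<in> sets borel \<Longrightarrow> measure N A = (\<integral>x. f x * indicator A x \<partial>lborel)"
    using real_density[OF N(1-3)] by blast
  let ?I = "{-\<eta><..\<eta>}"
  have sp: "space N = UNIV" using sets_eq_imp_space_eq[OF N(2)] by simp
  have "measure N {-1..1} \<le> measure N ?I"
    using \<eta> N(2) by (intro N.finite_measure_mono) auto
  then have I: "measure N ?I = 1" using N(4) N.prob_le_1[of ?I] by simp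
  have full: "measure N (X \<inter> ?I) = measure N X" if "X \<in> sets borel" for X
    using that N(2) I by (intro N.measure_space_inter) (auto simp: sp N.prob_space[unfolded sp])
  have "measure N (scaled n \<inter> ?I) = measure N P" for n
  proof -
    have "(sym_doubling \<eta> ^^ n) x \<in> P \<longleftrightarrow> x \<in> scaled n" for x
    proof -
      obtain k :: int where k: "(sym_doubling \<eta> ^^ n) x = 2 ^ n * x - of_int k * \<eta>"
        using sym_doubling_cong by blast
      then have "(sym_doubling \<eta> ^^ n) x = 2 ^ n * x + of_int (- k) * \<eta>" by simp
      then show ?thesis using shift_int[of "2 ^ n * x" "- k"] by (simp only: scaled_def mem_Collect_eq)
    qed
    then have "scaled n = {x. (sym_doubling \<eta> ^^ n) x \<in> P}" by auto
    then have "measure N (scaled n) = measure N P" using measure_iterate_preimage[OF N(2,5) borel_P] by simp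
    then show ?thesis using full[of "scaled n"] by simp
  qed
  moreover have "measure N (scaled n \<inter> ?I) = (\<integral>x. f x * indicator (scaled n \<inter> ?I) x \<partial>lborel)" for n
    by (rule f(2)) measurable
  ultimately have "(\<lambda>n::nat. measure N P) \<longlonglongrightarrow> mean * (\<integral>x. f x * indicator ?I x \<partial>lborel)"
    using equidistribution_integrable[OF f(1)] by simp
  then show ?thesis
    using I f(2)[of ?I] by (simp add: LIMSEQ_const_iff)
qed

text \<open>
  The representative of \<open>x\<close> modulo \<open>\<eta>\<close> in \<open>[-1, \<eta> - 1)\<close>: in a pair \<open>(x, x - \<eta>)\<close> it selects the left point.
\<close>
definition wrap :: "real \<Rightarrow> real \<Rightarrow> real" where
  "wrap \<eta> x = x - of_int \<lfloor>(x + 1) / \<eta>\<rfloor> * \<eta>"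

lemma wrap_shift: "\<eta> > 0 \<Longrightarrow> wrap \<eta> (x + \<eta>) = wrap \<eta> x"
proof -
  assume "\<eta> > 0"
  then have "(x + \<eta> + 1) / \<eta> = (x + 1) / \<eta> + 1" by (simp add: field_simps)
  then have "\<lfloor>(x + \<eta> + 1) / \<eta>\<rfloor> = \<lfloor>(x + 1) / \<eta>\<rfloor> + 1" by linarith
  then show ?thesis by (simp add: wrap_def algebra_simps)
qed

lemma wrap_cases:
  assumes "1 < \<eta>" "x \<in> {-1..1}"
  shows "wrap \<eta> x = x \<or> (x \<in> {\<eta> - 1..1} \<and> wrap \<eta> x = x - \<eta>)"
proof (cases "x < \<eta> - 1")
  case True
  then have "\<lfloor>(x + 1) / \<eta>\<rfloor> = 0" using assms by (auto simp: floor_eq_iff field_simps)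
  then show ?thesis by (simp add: wrap_def)
next
  case False
  then have "\<lfloor>(x + 1) / \<eta>\<rfloor> = 1" using assms by (auto simp: floor_eq_iff field_simps)
  then show ?thesis using False assms by (simp add: wrap_def)
qed

lemma wrap_measurable [measurable]: "wrap \<eta> \<in> borel_measurable borel"
  unfolding wrap_def by measurable

text \<open>
  Replacing \<open>x\<close> by its representative turns the event \<open>S\<^sub>\<eta>\<^sup>n x \<in> A\<close> into a periodic one and alters it only at points
  whose pair has survived \<open>n\<close> steps, a set of vanishing measure. The left-hand sequence does not mention the
  measure \<open>N\<close>.
\<close>
lemma measure_as_limit_of_means:
  assumes N: "prob_space N" "sets N = sets borel" "absolutely_continuous lborel N"
    "measure N {-1..1} = 1" "distr N borel (sym_doubling \<eta>) = N"
    and \<eta>: "1 < \<eta>" and A [measurable]: "A \<in> sets borel"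
  shows "(\<lambda>n. periodic_set.mean \<eta> {x. (sym_doubling \<eta> ^^ n) (wrap \<eta> x) \<in> A}) \<longlonglongrightarrow> measure N A"
proof -
  interpret N: prob_space N by fact
  have sp: "space N = UNIV" using sets_eq_imp_space_eq[OF N(2)] by simp
  let ?Q = "\<lambda>n. {x. (sym_doubling \<eta> ^^ n) (wrap \<eta> x) \<in> A}"
  let ?T = "\<lambda>n. {x. (sym_doubling \<eta> ^^ n) x \<in> A}"
  let ?E = "\<lambda>n. {x \<in> {\<eta> - 1..1}. survives \<eta> x n}"
  have Q [measurable]: "?Q n \<in> sets borel" and T [measurable]: "?T n \<in> sets borel" for n
    using measurable_sets_borel[OF sym_doubling_iterate_measurable[where \<eta>=\<eta> and n=n] A]
      measurable_sets_borel[OF measurable_comp[OF wrap_measurable[of \<eta>] sym_doubling_iterate_measurable[where \<eta>=\<eta> and n=n]] A]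
    by (simp_all add: vimage_def)
  have mean: "periodic_set.mean \<eta> (?Q n) = measure N (?Q n)" for n
  proof -
    have "periodic_set \<eta> (?Q n)"
      using \<eta> by unfold_locales (simp_all add: wrap_shift)
    then show ?thesis using measure_periodic_set[OF N \<eta>] by simp
  qed
  have ae: "AE x in N. x \<in> {-1..1}"
    using N.AE_prob_1[of "{-1..1}"] N(4) by simp
  have mono: "measure N X \<le> measure N Y + measure N (?E n)"
    if [measurable]: "X \<in> sets borel" "Y \<in> sets borel" and "\<And>x. x \<in> {-1..1} \<Longrightarrow> x \<in> X \<Longrightarrow> x \<in> Y \<or> x \<in> ?E n" for X Y n
  proof -
    have "measure N X \<le> measure N (Y \<union> ?E n)"
    proof (rule N.finite_measure_mono_AE)
      show "AE x in N. x \<in> X \<longrightarrow> x \<in> Y \<union> ?E n" using ae by eventually_elim (use that(3) in auto)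
      have "Y \<union> ?E n \<in> sets borel" by measurable
      then show "Y \<union> ?E n \<in> sets N" using N(2) by simp
    qed
    also have "\<dots> \<le> measure N Y + measure N (?E n)"
      by (rule measure_Un_le) (simp_all add: N(2))
    finally show ?thesis .
  qed
  have "\<bar>measure N (?Q n) - measure N A\<bar> \<le> measure N (?E n)" for n
  proof -
    have same: "(sym_doubling \<eta> ^^ n) (wrap \<eta> x) = (sym_doubling \<eta> ^^ n) x" if "x \<in> {-1..1}" "x \<notin> ?E n" for x
      using wrap_cases[OF \<eta> that(1)] pair_merges[OF \<eta>, of x n] that(2) by auto
    have iff: "x \<in> ?Q n \<longleftrightarrow> x \<in> ?T n" if "x \<in> {-1..1}" "x \<notin> ?E n" for x
      using same[OF that] by simp
    have "measure N (?Q n) \<le> measure N (?T n) + measure N (?E n)"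
      by (rule mono[OF Q T]) (use iff in blast)
    moreover have "measure N (?T n) \<le> measure N (?Q n) + measure N (?E n)"
      by (rule mono[OF T Q]) (use iff in blast)
    ultimately show ?thesis using measure_iterate_preimage[OF N(2,5) A, of n] by simp
  qed
  then have "\<forall>\<^sub>F n in sequentially. norm (measure N (?Q n) - measure N A) \<le> measure N (?E n)"
    by simp
  from Lim_null_comparison[OF this survivors_measure_tendsto_0[OF N(1-3) \<eta>]]
  show ?thesis unfolding mean by (simp add: LIM_zero_iff)
qed

lemma invariant_ac_prob_unique:
  assumes "invariant_ac_prob \<eta> M" "invariant_ac_prob \<eta> M'" "1 < \<eta>"
  shows "M = M'"
proof (rule measure_eqI)
  show s: "sets M = sets M'" using assms by (simp add: invariant_ac_prob_def)
  fix A assume A: "A \<in> sets M"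
  then have A': "A \<in> sets M'" using s by simp
  note L = line_measure_properties[OF assms(1)] and L' = line_measure_properties[OF assms(2)]
  have b: "A \<in> sets borel" using L(6)[OF A] by simp
  have "measure (line_measure M) A = measure (line_measure M') A"
    using measure_as_limit_of_means[OF L(1,2,3,5,4) assms(3) b]
      measure_as_limit_of_means[OF L'(1,2,3,5,4) assms(3) b]
    by (rule LIMSEQ_unique)
  then have "emeasure (line_measure M) A = emeasure (line_measure M') A"
    using L(1) L'(1) by (simp add: finite_measure.emeasure_eq_measure prob_space.finite_measure)
  then show "emeasure M A = emeasure M' A" using L(6)[OF A] L'(6)[OF A'] by simp
qed


section \<open>The invariant density\<close>
definition cdf_on :: "real set \<Rightarrow> real \<Rightarrow> real" where
  "cdf_on A x = measure lborel (A \<inter> {..x})"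

lemma cdf_on_diff:
  assumes [measurable]: "A \<in> sets borel" and A: "A \<subseteq> {-1..1}" and "a \<le> b"
  shows "cdf_on A b - cdf_on A a = measure lborel (A \<inter> {a<..b})"
proof -
  have fm: "emeasure lborel (A \<inter> X) \<noteq> \<infinity>" for X
  proof -
    have "emeasure lborel (A \<inter> X) \<le> emeasure lborel {-1..1::real}"
      using A by (intro emeasure_mono) auto
    then show ?thesis by (auto simp: top_unique)
  qed
  have "A \<inter> {..b} = (A \<inter> {..a}) \<union> (A \<inter> {a<..b})" using \<open>a \<le> b\<close> by auto
  moreover have "measure lborel ((A \<inter> {..a}) \<union> (A \<inter> {a<..b})) = measure lborel (A \<inter> {..a}) + measure lborel (A \<inter> {a<..b})"
    using fm by (intro measure_Union) auto
  ultimately show ?thesis by (simp add: cdf_on_def)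
qed

lemma measure_open_eq_half_open:
  fixes a b :: real
  assumes [measurable]: "A \<in> sets borel"
  shows "measure lborel (A \<inter> {a<..<b}) = measure lborel (A \<inter> {a<..b})"
  by (rule measure_eq_AE, use AE_lborel_singleton[of b] in eventually_elim) auto

definition preimage :: "real \<Rightarrow> real set \<Rightarrow> real set" where
  "preimage \<eta> A = {y \<in> {-1..1}. sym_doubling \<eta> y \<in> A}"

lemma preimage_measurable:
  assumes "A \<in> sets borel" shows "preimage \<eta> A \<in> sets borel"
proof -
  have "preimage \<eta> A = {-1..1} \<inter> (sym_doubling \<eta> -` A)" by (auto simp: preimage_def)
  then show ?thesis using measurable_sets_borel[OF sym_doubling_measurable assms] by simp
qed

lemma preimage_branch:
  assumes A [measurable]: "A \<in> sets borel" "A \<subseteq> {-1..1}"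
    and "-1 \<le> a" "a \<le> b" "b \<le> 1"
    and branch: "\<And>y. a < y \<Longrightarrow> y < b \<Longrightarrow> sym_doubling \<eta> y = 2 * y + c"
  shows "cdf_on (preimage \<eta> A) b - cdf_on (preimage \<eta> A) a
     = (cdf_on A (2 * b + c) - cdf_on A (2 * a + c)) / 2"
proof -
  note [measurable] = preimage_measurable[OF A(1), of \<eta>]
  have "cdf_on (preimage \<eta> A) b - cdf_on (preimage \<eta> A) a = measure lborel (preimage \<eta> A \<inter> {a<..b})"
    using assms by (intro cdf_on_diff preimage_measurable) (auto simp: preimage_def)
  also have "\<dots> = measure lborel (preimage \<eta> A \<inter> {a<..<b})"
    by (rule measure_open_eq_half_open[symmetric]) measurable
  also have "preimage \<eta> A \<inter> {a<..<b} = {y. 2 * y + c \<in> A \<inter> {2 * a + c<..<2 * b + c}}"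
    using assms by (auto simp: preimage_def)
  also have "measure lborel \<dots> = measure lborel (A \<inter> {2 * a + c<..<2 * b + c}) / 2"
    by (rule measure_lborel_affine) auto
  also have "measure lborel (A \<inter> {2 * a + c<..<2 * b + c}) = measure lborel (A \<inter> {2 * a + c<..2 * b + c})"
    by (rule measure_open_eq_half_open) measurable
  also have "\<dots> = cdf_on A (2 * b + c) - cdf_on A (2 * a + c)"
    using assms by (intro cdf_on_diff[symmetric]) auto
  finally show ?thesis .
qed

text \<open>
  Lebesgue measure on the window \<open>(t - \<eta>, t]\<close> plus its mirror image. Symmetrising is what closes the family under
  \<open>S\<^sub>\<eta>\<close>: a single window also produces the mirror image of the window of \<open>1\<close>.
\<close>
definition window :: "real \<Rightarrow> real \<Rightarrow> real set \<Rightarrow> real" where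
  "window \<eta> t A = measure lborel (A \<inter> {t - \<eta><..t}) + measure lborel (A \<inter> {- t<..\<eta> - t})"

lemma window_cdf:
  assumes "A \<in> sets borel" "A \<subseteq> {-1..1}" "0 < \<eta>"
  shows "window \<eta> t A = cdf_on A t - cdf_on A (t - \<eta>) + (cdf_on A (\<eta> - t) - cdf_on A (- t))"
  unfolding window_def using assms by (simp add: cdf_on_diff)

text \<open>
  The window of \<open>t\<close> is cut at \<open>-1/2\<close> and \<open>1/2\<close> and each piece is doubled. Since a window is a full period, its
  image covers the circle evenly. If the pair of \<open>t\<close> survives, one cut falls inside the window, and the images reassemble
  on \<open>[-1,1]\<close> into the window of \<open>S\<^sub>\<eta> t\<close> and that of \<open>1\<close> or its mirror image. If the pair merges, both cuts
  fall inside, and the window of \<open>1\<close> and its mirror image remain. The cut at \<open>1/2\<close> creates the end points \<open>1\<close> and \<open>1 - \<eta>\<close>, the cut at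
  \<open>-1/2\<close> their mirror images.
\<close>
lemma window_preimage:
  assumes A: "A \<in> sets borel" "A \<subseteq> {-1..1}" and \<eta>: "1 < \<eta>" "\<eta> \<le> 2" and t: "\<eta> - 1 \<le> t" "t \<le> 1"
  shows "t \<le> 1/2 \<or> \<eta> - 1/2 \<le> t \<Longrightarrow>
      window \<eta> t (preimage \<eta> A) = (window \<eta> (sym_doubling \<eta> t) A + window \<eta> 1 A) / 2"
    and "\<not> (t \<le> 1/2 \<or> \<eta> - 1/2 \<le> t) \<Longrightarrow> window \<eta> t (preimage \<eta> A) = window \<eta> 1 A"
proof -
  let ?F = "cdf_on (preimage \<eta> A)" and ?G = "cdf_on A"
  have "preimage \<eta> A \<subseteq> {-1..1}" by (auto simp: preimage_def)
  note wP = window_cdf[OF preimage_measurable[OF A(1)] this, of \<eta>]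
    and wA = window_cdf[OF A, of \<eta>]
  have left: "?F b - ?F a = (?G (2 * b + \<eta>) - ?G (2 * a + \<eta>)) / 2" if "-1 \<le> a" "a \<le> b" "b \<le> -1/2" for a b
    using that by (intro preimage_branch[OF A]) (auto simp: sym_doubling_def first_digit_def)
  have mid: "?F b - ?F a = (?G (2 * b) - ?G (2 * a)) / 2" if "-1/2 \<le> a" "a \<le> b" "b \<le> 1/2" for a b
    using preimage_branch[OF A, of a b \<eta> 0] that by (auto simp: sym_doubling_def first_digit_def)
  have right: "?F b - ?F a = (?G (2 * b - \<eta>) - ?G (2 * a - \<eta>)) / 2" if "1/2 \<le> a" "a \<le> b" "b \<le> 1" for a b
    using preimage_branch[OF A, of a b \<eta> "-\<eta>"] that by (auto simp: sym_doubling_def first_digit_def)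
  have ends: "2 * (- 1 / 2) + \<eta> = \<eta> - 1" "2 * (- 1 / 2) = (- 1::real)" "2 * (1 / 2) = (1::real)"
     "2 * (1 / 2) - \<eta> = 1 - \<eta>" by simp_all
  show "window \<eta> t (preimage \<eta> A) = (window \<eta> (sym_doubling \<eta> t) A + window \<eta> 1 A) / 2"
    if "t \<le> 1/2 \<or> \<eta> - 1/2 \<le> t"
  proof (cases "t \<le> 1/2")
    case True
    have "?F t - ?F (-1/2) = (?G (2 * t) - ?G (-1)) / 2"
      "?F (-1/2) - ?F (t - \<eta>) = (?G (\<eta> - 1) - ?G (2 * t - \<eta>)) / 2"
      "?F (1/2) - ?F (-t) = (?G 1 - ?G (- (2 * t))) / 2"
      "?F (\<eta> - t) - ?F (1/2) = (?G (\<eta> - 2 * t) - ?G (1 - \<eta>)) / 2"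
      using mid[of "-1/2" t] left[of "t - \<eta>" "-1/2"] mid[of "-t" "1/2"] right[of "1/2" "\<eta> - t"]
        True \<eta> t by (simp_all add: algebra_simps)
    moreover have st: "sym_doubling \<eta> t = 2 * t" using pair_step(1)[of \<eta> t] True \<eta> t by simp
    ultimately show ?thesis using \<eta> by (simp add: st wP wA field_simps)
  next
    case False
    with that have t2: "1/2 < t" "\<eta> - 1/2 \<le> t" by auto
    have "?F t - ?F (1/2) = (?G (2 * t - \<eta>) - ?G (1 - \<eta>)) / 2"
      "?F (1/2) - ?F (t - \<eta>) = (?G 1 - ?G (2 * t - \<eta> - \<eta>)) / 2"
      "?F (\<eta> - t) - ?F (-1/2) = (?G (\<eta> - (2 * t - \<eta>)) - ?G (-1)) / 2"
      "?F (-1/2) - ?F (-t) = (?G (\<eta> - 1) - ?G (- (2 * t - \<eta>))) / 2"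
      using right[of "1/2" t] mid[of "t - \<eta>" "1/2"] mid[of "-1/2" "\<eta> - t"] left[of "-t" "-1/2"]
        t2 \<eta> t by (simp_all add: algebra_simps)
    moreover have st: "sym_doubling \<eta> t = 2 * t - \<eta>" using pair_step(2)[of \<eta> t] t2 \<eta> t by simp
    ultimately show ?thesis using \<eta> by (simp add: st wP wA field_simps)
  qed
  show "window \<eta> t (preimage \<eta> A) = window \<eta> 1 A" if "\<not> (t \<le> 1/2 \<or> \<eta> - 1/2 \<le> t)"
  proof -
    have "?F t - ?F (1/2) = (?G (2 * t - \<eta>) - ?G (1 - \<eta>)) / 2"
      "?F (1/2) - ?F (-1/2) = (?G 1 - ?G (-1)) / 2"
      "?F (-1/2) - ?F (t - \<eta>) = (?G (\<eta> - 1) - ?G (2 * t - \<eta>)) / 2"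
      "?F (\<eta> - t) - ?F (1/2) = (?G (\<eta> - 2 * t) - ?G (1 - \<eta>)) / 2"
      "?F (-1/2) - ?F (-t) = (?G (\<eta> - 1) - ?G (\<eta> - 2 * t)) / 2"
      using right[of "1/2" t] mid[of "-1/2" "1/2"] left[of "t - \<eta>" "-1/2"]
        right[of "1/2" "\<eta> - t"] left[of "-t" "-1/2"]
        that \<eta> t by (simp_all add: algebra_simps)
    then show ?thesis using \<eta> by (simp add: wP wA field_simps)
  qed
qed

text \<open>
  Truncating the weights at the matching time, instead of the range of summation, allows one formula for finite and
  infinite matching index.
\<close>
definition weight :: "real \<Rightarrow> nat \<Rightarrow> real" where
  "weight \<eta> n = (if survives \<eta> 1 n then (1/2) ^ n else 0)"

definition total_weight :: "real \<Rightarrow> real" where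
  "total_weight \<eta> = (\<Sum>n. weight \<eta> n)"

lemma weight_bounds: "0 \<le> weight \<eta> n" "weight \<eta> n \<le> (1/2) ^ n"
  by (auto simp: weight_def)

lemma weight_0: "weight \<eta> 0 = 1"
  by (simp add: weight_def survives_def)

lemma summable_weight_mult:
  assumes "\<And>n. weight \<eta> n \<noteq> 0 \<Longrightarrow> \<bar>f n\<bar> \<le> B"
  shows "summable (\<lambda>n. weight \<eta> n * f n)"
proof (rule summable_comparison_test')
  show "summable (\<lambda>n. (1/2::real) ^ n * \<bar>B\<bar>)"
    by (intro summable_mult2 summable_geometric) simp
  fix n
  show "norm (weight \<eta> n * f n) \<le> (1/2) ^ n * \<bar>B\<bar>"
  proof (cases "weight \<eta> n = 0")
    case False
    have "\<bar>weight \<eta> n\<bar> * \<bar>f n\<bar> \<le> (1/2) ^ n * \<bar>B\<bar>"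
      using weight_bounds[of \<eta> n] assms[OF False] by (intro mult_mono) auto
    then show ?thesis by (simp add: abs_mult)
  qed simp
qed

lemma summable_weight: "summable (weight \<eta>)"
  using summable_weight_mult[of \<eta> "\<lambda>_. 1" 1] by simp

lemma total_weight_ge_1: "1 \<le> total_weight \<eta>"
  using sum_le_suminf[OF summable_weight, of "{0}" \<eta>] weight_bounds
  by (simp add: total_weight_def weight_0)

text \<open>
  Both cases of \<open>window_preimage\<close> in one formula: a surviving step loses half of the weight to the window of \<open>1\<close>, a
  merging step loses all of it. Summed over \<open>n\<close>, the lost weights telescope to the weight of the window of \<open>1\<close>
  at \<open>n = 0\<close>.
\<close>
lemma weight_window_step:
  assumes A: "A \<in> sets borel" "A \<subseteq> {-1..1}" and \<eta>: "1 < \<eta>" "\<eta> \<le> 2"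
  shows "weight \<eta> n * window \<eta> (orbit_one \<eta> n) (preimage \<eta> A)
       = weight \<eta> (Suc n) * window \<eta> (orbit_one \<eta> (Suc n)) A
         + (weight \<eta> n - weight \<eta> (Suc n)) * window \<eta> 1 A"
proof (cases "survives \<eta> 1 n")
  case False
  then have "\<not> survives \<eta> 1 (Suc n)" unfolding survives_def using less_SucI by blast
  with False show ?thesis by (simp add: weight_def)
next
  case True
  let ?t = "orbit_one \<eta> n"
  have t: "\<eta> - 1 \<le> ?t" "?t \<le> 1" using orbit_one_mem[of \<eta> n] \<eta> True by auto
  have iff: "survives \<eta> 1 (Suc n) \<longleftrightarrow> ?t \<le> 1/2 \<or> \<eta> - 1/2 \<le> ?t"
    using True int_dist_gap(2)[of \<eta> ?t] int_dist_orbit[of \<eta> n 1] t \<eta>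
    by (auto simp: survives_def less_Suc_eq)
  show ?thesis
    using window_preimage[OF A \<eta> t] True iff by (cases "survives \<eta> 1 (Suc n)") (auto simp: weight_def field_simps)
qed

lemma window_bounds:
  assumes [measurable]: "A \<in> sets borel" and "0 < \<eta>"
  shows "0 \<le> window \<eta> t A" "window \<eta> t A \<le> 2 * \<eta>"
proof -
  show "0 \<le> window \<eta> t A" by (simp add: window_def)
  have "measure lborel (A \<inter> {a<..a + \<eta>}) \<le> measure lborel {a<..a + \<eta>}" for a
    using assms(2) fmeasurable_Int_interval[of UNIV] by (intro measure_mono_fmeasurable) auto
  from this[of "t - \<eta>"] this[of "- t"] show "window \<eta> t A \<le> 2 * \<eta>"
    using assms(2) by (simp add: window_def)
qed

lemma suminf_weight_window_invariant:
  assumes A: "A \<in> sets borel" "A \<subseteq> {-1..1}" and \<eta>: "1 < \<eta>" "\<eta> \<le> 2"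
  shows "(\<Sum>n. weight \<eta> n * window \<eta> (orbit_one \<eta> n) (preimage \<eta> A))
       = (\<Sum>n. weight \<eta> n * window \<eta> (orbit_one \<eta> n) A)"
proof -
  let ?f = "\<lambda>n. weight \<eta> n * window \<eta> (orbit_one \<eta> n) A"
  have s: "summable ?f"
    using window_bounds[OF A(1)] \<eta> by (intro summable_weight_mult[where B = "2 * \<eta>"]) (simp add: abs_le_iff)
  have "weight \<eta> \<longlonglongrightarrow> 0" using summable_LIMSEQ_zero[OF summable_weight] .
  then have tel: "(\<lambda>n. weight \<eta> n - weight \<eta> (Suc n)) sums (weight \<eta> 0 - 0)"
    by (rule telescope_sums')
  have "(\<lambda>n. ?f (Suc n)) sums (suminf ?f - ?f 0)"
    using s by (subst sums_Suc_iff) (simp add: summable_sums)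
  from sums_add[OF this sums_mult2[OF tel, of "window \<eta> 1 A"]]
  have "(\<lambda>n. weight \<eta> n * window \<eta> (orbit_one \<eta> n) (preimage \<eta> A)) sums suminf ?f"
    unfolding weight_window_step[OF A \<eta>] by (simp add: weight_0)
  then show ?thesis by (simp add: sums_iff)
qed

text \<open>
  Each pair of windows has total length \<open>2 \<eta>\<close>, hence the normalising factor.
\<close>
definition inv_density :: "real \<Rightarrow> real \<Rightarrow> ennreal" where
  "inv_density \<eta> x = (\<Sum>n. ennreal (weight \<eta> n / (2 * \<eta> * total_weight \<eta>))
     * (indicator {orbit_one \<eta> n - \<eta><..orbit_one \<eta> n} x + indicator {- orbit_one \<eta> n<..\<eta> - orbit_one \<eta> n} x))"

lemma inv_density_measurable [measurable]: "inv_density \<eta> \<in> borel_measurable borel"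
  unfolding inv_density_def by measurable

definition acim :: "real \<Rightarrow> real measure" where
  "acim \<eta> = density (restrict_space lborel {-1..1}) (inv_density \<eta>)"

lemma emeasure_acim:
  assumes A [measurable]: "A \<in> sets borel" "A \<subseteq> {-1..1}" and "1 < \<eta>"
  shows "emeasure (acim \<eta>) A = ennreal ((\<Sum>n. weight \<eta> n * window \<eta> (orbit_one \<eta> n) A) / (2 * \<eta> * total_weight \<eta>))"
proof -
  let ?c = "\<lambda>n. weight \<eta> n / (2 * \<eta> * total_weight \<eta>)"
  let ?i = "\<lambda>n x. indicator {orbit_one \<eta> n - \<eta><..orbit_one \<eta> n} x + indicator {- orbit_one \<eta> n<..\<eta> - orbit_one \<eta> n} x :: ennreal"
  have c: "0 \<le> ?c n" for n using weight_bounds[of \<eta> n] total_weight_ge_1[of \<eta>] assms(3) by simp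
  have summ: "summable (\<lambda>n. weight \<eta> n * window \<eta> (orbit_one \<eta> n) A)"
    using window_bounds[OF A(1)] assms(3) by (intro summable_weight_mult[where B = "2 * \<eta>"]) (simp add: abs_le_iff)
  have "A \<in> sets (restrict_space lborel {-1..1})" using A by (subst sets_restrict_space_iff) auto
  moreover have "inv_density \<eta> \<in> borel_measurable (restrict_space lborel {-1..1})"
    by (rule measurable_restrict_space1) simp
  ultimately have "emeasure (acim \<eta>) A = (\<integral>\<^sup>+x. inv_density \<eta> x * indicator A x \<partial>restrict_space lborel {-1..1})"
    unfolding acim_def by (subst emeasure_density) auto
  also have "\<dots> = (\<integral>\<^sup>+x. inv_density \<eta> x * indicator A x * indicator {-1..1} x \<partial>lborel)"
    by (rule nn_integral_restrict_space) simp
  also have "\<dots> = (\<integral>\<^sup>+x. (\<Sum>n. ennreal (?c n) * (?i n x * indicator A x)) \<partial>lborel)"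
    using A(2) by (intro nn_integral_cong) (auto simp: inv_density_def indicator_def)
  also have "\<dots> = (\<Sum>n. \<integral>\<^sup>+x. ennreal (?c n) * (?i n x * indicator A x) \<partial>lborel)"
    by (rule nn_integral_suminf) measurable
  also have "\<dots> = (\<Sum>n. ennreal (?c n * window \<eta> (orbit_one \<eta> n) A))"
  proof (rule arg_cong[of _ _ suminf], rule ext)
    fix n
    have fin: "emeasure lborel (A \<inter> {a<..b}) = ennreal (measure lborel (A \<inter> {a<..b}))" for a b
      by (rule emeasure_eq_ennreal_measure) (use fmeasurable_Int_interval[OF A(1), THEN fmeasurableD2] in simp)
    have "(\<integral>\<^sup>+x. ennreal (?c n) * (?i n x * indicator A x) \<partial>lborel)
        = ennreal (?c n) * (\<integral>\<^sup>+x. ?i n x * indicator A x \<partial>lborel)"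
      by (rule nn_integral_cmult) measurable
    also have "(\<integral>\<^sup>+x. ?i n x * indicator A x \<partial>lborel)
        = (\<integral>\<^sup>+x. indicator (A \<inter> {orbit_one \<eta> n - \<eta><..orbit_one \<eta> n}) x
             + indicator (A \<inter> {- orbit_one \<eta> n<..\<eta> - orbit_one \<eta> n}) x \<partial>lborel)"
      by (intro nn_integral_cong) (auto simp: indicator_def)
    also have "\<dots> = emeasure lborel (A \<inter> {orbit_one \<eta> n - \<eta><..orbit_one \<eta> n})
         + emeasure lborel (A \<inter> {- orbit_one \<eta> n<..\<eta> - orbit_one \<eta> n})"
      by (subst nn_integral_add) auto
    also have "\<dots> = ennreal (window \<eta> (orbit_one \<eta> n) A)"
      unfolding fin window_def by simp
    finally show "(\<integral>\<^sup>+x. ennreal (?c n) * (?i n x * indicator A x) \<partial>lborel)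
        = ennreal (?c n * window \<eta> (orbit_one \<eta> n) A)"
      unfolding ennreal_mult'[OF c] .
  qed
  also have "\<dots> = ennreal (\<Sum>n. ?c n * window \<eta> (orbit_one \<eta> n) A)"
  proof (rule suminf_ennreal2)
    show "0 \<le> ?c n * window \<eta> (orbit_one \<eta> n) A" for n
      using c window_bounds(1)[OF A(1)] assms(3) by (intro mult_nonneg_nonneg) auto
    from summable_divide[OF summ, of "2 * \<eta> * total_weight \<eta>"]
    show "summable (\<lambda>n. ?c n * window \<eta> (orbit_one \<eta> n) A)" by simp
  qed
  also have "(\<Sum>n. ?c n * window \<eta> (orbit_one \<eta> n) A)
     = (\<Sum>n. weight \<eta> n * window \<eta> (orbit_one \<eta> n) A) / (2 * \<eta> * total_weight \<eta>)"
    using suminf_divide[OF summ, of "2 * \<eta> * total_weight \<eta>"] by simp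
  finally show ?thesis .
qed

lemma sym_doubling_self_map:
  assumes "1 \<le> \<eta>" "\<eta> \<le> 2" "x \<in> {-1..1}"
  shows "sym_doubling \<eta> x \<in> {-1..1}"
  using assms by (auto simp: sym_doubling_def first_digit_def)

lemma invariant_ac_prob_acim:
  assumes \<eta>: "1 < \<eta>" "\<eta> \<le> 2"
  shows "invariant_ac_prob \<eta> (acim \<eta>)"
proof -
  have meas: "inv_density \<eta> \<in> borel_measurable (restrict_space lborel {-1..1})"
    by (rule measurable_restrict_space1) simp
  have sets: "sets (acim \<eta>) = sets (restrict_space borel {-1..1})"
    unfolding acim_def sets_density by (rule sets_restrict_space_cong) simp
  have space: "space (acim \<eta>) = {-1..1}" by (simp add: acim_def space_restrict_space)
  have in_sets: "A \<in> sets (acim \<eta>) \<longleftrightarrow> A \<in> sets borel \<and> A \<subseteq> {-1..1}" for A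
    unfolding sets by (subst sets_restrict_space_iff) auto
  have "weight \<eta> n * window \<eta> (orbit_one \<eta> n) {-1..1} = weight \<eta> n * (2 * \<eta>)" for n
  proof (cases "survives \<eta> 1 n")
    case True
    then have "orbit_one \<eta> n \<in> {\<eta> - 1..1}" using orbit_one_mem[of \<eta> n] \<eta> by simp
    then have "{-1..1} \<inter> {orbit_one \<eta> n - \<eta><..orbit_one \<eta> n} = {orbit_one \<eta> n - \<eta><..orbit_one \<eta> n}"
      "{-1..1} \<inter> {- orbit_one \<eta> n<..\<eta> - orbit_one \<eta> n} = {- orbit_one \<eta> n<..\<eta> - orbit_one \<eta> n}" by auto
    then show ?thesis using \<eta> by (simp add: window_def)
  qed (simp add: weight_def)
  then have "(\<Sum>n. weight \<eta> n * window \<eta> (orbit_one \<eta> n) {-1..1}) = (\<Sum>n. weight \<eta> n * (2 * \<eta>))"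
    by (simp only:)
  also have "\<dots> = total_weight \<eta> * (2 * \<eta>)"
    using suminf_mult2[OF summable_weight, of \<eta> "2 * \<eta>"] by (simp add: total_weight_def)
  finally have "(\<Sum>n. weight \<eta> n * window \<eta> (orbit_one \<eta> n) {-1..1}) = total_weight \<eta> * (2 * \<eta>)" .
  then have "emeasure (acim \<eta>) {-1..1} = 1"
    using emeasure_acim[of "{-1..1}" \<eta>] \<eta> total_weight_ge_1[of \<eta>] by simp
  then have prob: "prob_space (acim \<eta>)" by (intro prob_spaceI) (simp add: space)
  have map: "sym_doubling \<eta> \<in> measurable (acim \<eta>) (acim \<eta>)"
  proof (rule measurableI)
    show "sym_doubling \<eta> x \<in> space (acim \<eta>)" if "x \<in> space (acim \<eta>)" for x
      using sym_doubling_self_map[of \<eta> x] that \<eta> by (simp add: space)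
    fix A assume "A \<in> sets (acim \<eta>)"
    moreover have "sym_doubling \<eta> -` A \<inter> space (acim \<eta>) = preimage \<eta> A" by (auto simp: preimage_def space)
    ultimately show "sym_doubling \<eta> -` A \<inter> space (acim \<eta>) \<in> sets (acim \<eta>)"
      using preimage_measurable[of A \<eta>] by (auto simp: in_sets preimage_def)
  qed
  have "distr (acim \<eta>) (acim \<eta>) (sym_doubling \<eta>) = acim \<eta>"
  proof (rule measure_eqI)
    fix A assume "A \<in> sets (distr (acim \<eta>) (acim \<eta>) (sym_doubling \<eta>))"
    then have A': "A \<in> sets (acim \<eta>)" by simp
    then have A: "A \<in> sets borel" "A \<subseteq> {-1..1}" by (auto simp: in_sets)
    have "emeasure (distr (acim \<eta>) (acim \<eta>) (sym_doubling \<eta>)) A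
        = emeasure (acim \<eta>) (sym_doubling \<eta> -` A \<inter> space (acim \<eta>))"
      by (rule emeasure_distr[OF map A'])
    also have "sym_doubling \<eta> -` A \<inter> space (acim \<eta>) = preimage \<eta> A" by (auto simp: preimage_def space)
    also have "emeasure (acim \<eta>) (preimage \<eta> A) = emeasure (acim \<eta>) A"
    proof -
      have "preimage \<eta> A \<subseteq> {-1..1}" by (auto simp: preimage_def)
      from emeasure_acim[OF preimage_measurable[OF A(1)] this \<eta>(1)] emeasure_acim[OF A \<eta>(1)]
      show ?thesis by (simp add: suminf_weight_window_invariant[OF A \<eta>])
    qed
    finally show "emeasure (distr (acim \<eta>) (acim \<eta>) (sym_doubling \<eta>)) A = emeasure (acim \<eta>) A" .
  qed simp
  moreover have "absolutely_continuous (restrict_space lborel {-1..1}) (acim \<eta>)"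
    unfolding acim_def using meas by (rule absolutely_continuousI_density)
  ultimately show ?thesis using sets prob map by (simp add: invariant_ac_prob_def)
qed

section \<open>The mass of the central interval\<close>
lemma measure_central_interval:
  fixes a b :: real
  assumes "a \<le> 0" "0 \<le> b"
  shows "measure lborel ({-1/2..1/2} \<inter> {a<..b}) = min b (1/2) - max a (-1/2)"
proof (cases "a < -1/2")
  case True
  then have "{-1/2..1/2} \<inter> {a<..b} = {-1/2..min b (1/2)}" by auto
  then show ?thesis using assms True by simp
next
  case False
  then have "{-1/2..1/2} \<inter> {a<..b} = {a<..min b (1/2)}" by auto
  then show ?thesis using assms False by simp
qed

definition clipped_dist :: "real \<Rightarrow> nat \<Rightarrow> real" where
  "clipped_dist \<eta> n = min (int_dist (2 ^ n / \<eta>)) (1 / (2 * \<eta>))"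

lemma clipped_dist_bounds: "\<eta> > 0 \<Longrightarrow> 0 \<le> clipped_dist \<eta> n" "\<eta> > 0 \<Longrightarrow> clipped_dist \<eta> n \<le> 1 / (2 * \<eta>)"
  by (auto simp: clipped_dist_def int_dist_nonneg)

text \<open>
  The windows reach from \<open>t - \<eta> \<le> 0\<close> to \<open>t \<ge> 0\<close>. As long as the pair survives, exactly one end lies in
  \<open>[-1/2, 1/2]\<close>, up to boundary cases, and its distance to \<open>0\<close> is \<open>\<eta> \<parallel>t / \<eta>\<parallel>\<close>; when it merges, the window
  contains the whole interval, whence the clipping at \<open>1 / (2 \<eta>)\<close>.
\<close>
lemma window_central:
  assumes \<eta>: "1 \<le> \<eta>" "\<eta> \<le> 2" and "survives \<eta> 1 n"
  shows "window \<eta> (orbit_one \<eta> n) {-1/2..1/2} = 2 * \<eta> * (clipped_dist \<eta> n + 1 / (2 * \<eta>))"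
proof -
  let ?t = "orbit_one \<eta> n"
  have t: "\<eta> - 1 \<le> ?t" "?t \<le> 1" using orbit_one_mem[of \<eta> n] assms by auto
  have "int_dist (2 ^ n / \<eta>) = min ?t (\<eta> - ?t) / \<eta>"
    using int_dist_gap(1)[of \<eta> ?t] int_dist_orbit[of \<eta> n 1] t \<eta> by simp
  then have "clipped_dist \<eta> n * \<eta> = min (min ?t (\<eta> - ?t)) (1/2)"
    using \<eta> by (auto simp: clipped_dist_def min_def field_simps)
  moreover have "window \<eta> ?t {-1/2..1/2} = min ?t (1/2) - max (?t - \<eta>) (-1/2) + (min (\<eta> - ?t) (1/2) - max (- ?t) (-1/2))"
    using measure_central_interval[of "?t - \<eta>" ?t] measure_central_interval[of "- ?t" "\<eta> - ?t"] t \<eta>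
    by (simp add: window_def)
  moreover have "2 * \<eta> * (clipped_dist \<eta> n + 1 / (2 * \<eta>)) = 2 * (clipped_dist \<eta> n * \<eta>) + 1"
    using \<eta> by (simp add: field_simps)
  ultimately show ?thesis using t \<eta> by (auto simp: min_def max_def)
qed

definition clipped_average :: "real \<Rightarrow> real" where
  "clipped_average \<eta> = (\<Sum>n. weight \<eta> n * clipped_dist \<eta> n) / total_weight \<eta>"

lemma summable_weight_clipped: "\<eta> > 0 \<Longrightarrow> summable (\<lambda>n. weight \<eta> n * clipped_dist \<eta> n)"
  using clipped_dist_bounds[of \<eta>] by (intro summable_weight_mult[where B = "1 / (2 * \<eta>)"]) (simp add: abs_le_iff)

lemma measure_acim_central:
  assumes \<eta>: "1 < \<eta>" "\<eta> \<le> 2"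
  shows "measure (acim \<eta>) {-1/2..1/2} = 1 / (2 * \<eta>) + clipped_average \<eta>"
proof -
  have "weight \<eta> n * window \<eta> (orbit_one \<eta> n) {-1/2..1/2}
      = 2 * \<eta> * (weight \<eta> n * clipped_dist \<eta> n + weight \<eta> n * (1 / (2 * \<eta>)))" for n
    using window_central[of \<eta> n] \<eta> by (cases "survives \<eta> 1 n") (auto simp: weight_def algebra_simps)
  moreover have "(\<lambda>n. 2 * \<eta> * (weight \<eta> n * clipped_dist \<eta> n + weight \<eta> n * (1 / (2 * \<eta>))))
      sums (2 * \<eta> * ((\<Sum>n. weight \<eta> n * clipped_dist \<eta> n) + total_weight \<eta> * (1 / (2 * \<eta>))))"
    unfolding total_weight_def
    using \<eta> by (intro sums_mult sums_add sums_mult2 summable_sums summable_weight_clipped summable_weight) simp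
  ultimately have s: "(\<Sum>n. weight \<eta> n * window \<eta> (orbit_one \<eta> n) {-1/2..1/2})
      = 2 * \<eta> * ((\<Sum>n. weight \<eta> n * clipped_dist \<eta> n) + total_weight \<eta> * (1 / (2 * \<eta>)))"
    by (simp only: sums_iff)
  have nonneg: "0 \<le> (\<Sum>n. weight \<eta> n * clipped_dist \<eta> n)"
    using \<eta> weight_bounds clipped_dist_bounds[of \<eta>]
    by (intro suminf_nonneg summable_weight_clipped mult_nonneg_nonneg) auto
  have "emeasure (acim \<eta>) {-1/2..1/2}
      = ennreal ((\<Sum>n. weight \<eta> n * window \<eta> (orbit_one \<eta> n) {-1/2..1/2}) / (2 * \<eta> * total_weight \<eta>))"
    using \<eta> by (intro emeasure_acim) auto
  also have "(\<Sum>n. weight \<eta> n * window \<eta> (orbit_one \<eta> n) {-1/2..1/2}) / (2 * \<eta> * total_weight \<eta>)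
      = 1 / (2 * \<eta>) + clipped_average \<eta>"
    unfolding s clipped_average_def using total_weight_ge_1[of \<eta>] \<eta> by (simp add: field_simps)
  finally have "emeasure (acim \<eta>) {-1/2..1/2} = ennreal (1 / (2 * \<eta>) + clipped_average \<eta>)" .
  moreover have "0 \<le> clipped_average \<eta>"
    unfolding clipped_average_def using nonneg total_weight_ge_1[of \<eta>] by simp
  ultimately show ?thesis using \<eta> by (simp add: measure_def del: ennreal_plus)
qed



section \<open>Continuity in the parameter\<close>

text \<open>
  Matching happens right after the first positive \<open>gap\<close>.
\<close>
definition gap :: "real \<Rightarrow> nat \<Rightarrow> real" where
  "gap \<eta> n = int_dist (2 ^ n / \<eta>) - 1 / (2 * \<eta>)"

lemma survives_one_gap: "survives \<eta> 1 n \<longleftrightarrow> (\<forall>j<n. gap \<eta> j \<le> 0)"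
  by (simp add: survives_def gap_def)

definition partial_average :: "real \<Rightarrow> nat \<Rightarrow> real" where
  "partial_average \<eta> k = (\<Sum>n<k. (1/2) ^ n * clipped_dist \<eta> n) / (\<Sum>n<k. (1/2) ^ n)"

lemma sum_half_powers_pos: "k > 0 \<Longrightarrow> 0 < (\<Sum>n<k. (1/2::real) ^ n)"
  by (intro sum_pos) auto

lemma weight_before: "survives \<eta> 1 k \<Longrightarrow> n \<le> k \<Longrightarrow> weight \<eta> n = (1/2) ^ n"
  by (auto simp: weight_def survives_def)

text \<open>
  The terms averaged lie in \<open>[0, 1/2]\<close> and the weights beyond \<open>k\<close> add up to at most \<open>2 (1/2)\<^sup>k\<close>.
\<close>
lemma clipped_average_approx:
  assumes \<eta>: "1 \<le> \<eta>" and k: "survives \<eta> 1 k" "0 < k"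
  shows "\<bar>clipped_average \<eta> - partial_average \<eta> k\<bar> \<le> (1/2) ^ k"
proof -
  let ?a = "clipped_dist \<eta>"
  have a: "0 \<le> ?a n" "?a n \<le> 1/2" for n
  proof -
    have "1 / (2 * \<eta>) \<le> 1/2" using \<eta> by (simp add: field_simps)
    then show "0 \<le> ?a n" "?a n \<le> 1/2" using clipped_dist_bounds[of \<eta> n] \<eta> by linarith+
  qed
  define A where "A = (\<Sum>n<k. (1/2) ^ n * ?a n)"
  define Z where "Z = (\<Sum>n<k. (1/2::real) ^ n)"
  define rA where "rA = (\<Sum>n. weight \<eta> (n + k) * ?a (n + k))"
  define rZ where "rZ = (\<Sum>n. weight \<eta> (n + k))"
  have sA: "summable (\<lambda>n. weight \<eta> n * ?a n)" using summable_weight_clipped \<eta> by simp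
  have sA': "summable (\<lambda>n. weight \<eta> (n + k) * ?a (n + k))" using sA by (subst summable_iff_shift)
  have sZ': "summable (\<lambda>n. weight \<eta> (n + k))" using summable_weight by (subst summable_iff_shift)
  have num: "(\<Sum>n. weight \<eta> n * ?a n) = rA + A"
    unfolding rA_def A_def suminf_split_initial_segment[OF sA, of k]
    using weight_before[OF k(1)] by (intro arg_cong2[of _ _ _ _ "(+)"] sum.cong) auto
  have den: "total_weight \<eta> = rZ + Z"
    unfolding rZ_def Z_def total_weight_def suminf_split_initial_segment[OF summable_weight, of _ k]
    using weight_before[OF k(1)] by (intro arg_cong2[of _ _ _ _ "(+)"] sum.cong) auto
  have "0 \<le> rA" unfolding rA_def using a weight_bounds(1) by (intro suminf_nonneg[OF sA'] mult_nonneg_nonneg) auto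
  have "0 \<le> rZ" unfolding rZ_def using weight_bounds(1) by (intro suminf_nonneg[OF sZ'])
  have "rA \<le> rZ * (1/2)"
    unfolding rA_def rZ_def suminf_mult2[OF sZ']
    using a weight_bounds(1) by (intro suminf_le sA' summable_mult2 sZ' mult_left_mono) auto
  have "rZ \<le> (\<Sum>n. (1/2) ^ n * (1/2) ^ k)"
    unfolding rZ_def using weight_bounds(2)[of \<eta>]
    by (intro suminf_le sZ' summable_mult2 summable_geometric) (auto simp: power_add[symmetric])
  also have "\<dots> = 2 * (1/2) ^ k"
    by (subst suminf_mult2[symmetric]) (auto simp: suminf_geometric summable_geometric)
  finally have "rZ \<le> 2 * (1/2) ^ k" .
  have "0 < Z" unfolding Z_def using k by (intro sum_half_powers_pos)
  have "0 \<le> A" unfolding A_def using a by (intro sum_nonneg) auto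
  have "A \<le> Z * (1/2)" unfolding A_def Z_def sum_distrib_right using a by (intro sum_mono mult_left_mono) auto
  define \<rho> where "\<rho> = A / Z"
  have \<rho>: "0 \<le> \<rho>" "\<rho> \<le> 1/2" "A = \<rho> * Z"
    unfolding \<rho>_def using \<open>0 < Z\<close> \<open>0 \<le> A\<close> \<open>A \<le> Z * (1/2)\<close> by (auto simp: field_simps)
  have T: "1 \<le> rZ + Z" using total_weight_ge_1[of \<eta>] den by simp
  have "0 \<le> \<rho> * rZ" "\<rho> * rZ \<le> (1/2) * rZ"
    using \<rho>(1) mult_right_mono[OF \<rho>(2) \<open>0 \<le> rZ\<close>] \<open>0 \<le> rZ\<close> by auto
  then have "\<bar>rA - \<rho> * rZ\<bar> \<le> rZ / 2" using \<open>0 \<le> rA\<close> \<open>rA \<le> rZ * (1/2)\<close> by linarith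
  also have "\<dots> \<le> (1/2) ^ k" using \<open>rZ \<le> 2 * (1/2) ^ k\<close> by simp
  finally have B: "\<bar>rA - \<rho> * rZ\<bar> \<le> (1/2) ^ k" .
  have "clipped_average \<eta> - partial_average \<eta> k = (rA + A) / (rZ + Z) - \<rho>"
    unfolding clipped_average_def partial_average_def num den \<rho>_def A_def Z_def ..
  also have "\<dots> = (rA - \<rho> * rZ) / (rZ + Z)" using T \<rho>(3) by (simp add: field_simps)
  finally have "\<bar>clipped_average \<eta> - partial_average \<eta> k\<bar> = \<bar>rA - \<rho> * rZ\<bar> / (rZ + Z)"
    using T by simp
  also have "\<dots> \<le> \<bar>rA - \<rho> * rZ\<bar>" using T by (simp add: divide_le_eq mult_le_cancel_left1)
  finally show ?thesis using B by simp
qed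

text \<open>
  If \<open>2\<^sup>k \<theta>\<close> has distance \<open>\<theta> / 2\<close> to an integer, then \<open>2\<^sup>k\<^sup>+\<^sup>1 \<theta>\<close> is \<open>\<plusminus>\<theta>\<close> modulo \<open>1\<close>, and the distance to
  the nearest integer does not see the sign.
\<close>
lemma int_dist_restart:
  assumes "int_dist (2 ^ k * \<theta>) = \<theta> / 2" "\<theta> \<ge> 0"
  shows "int_dist (2 ^ (n + Suc k) * \<theta>) = int_dist (2 ^ n * \<theta>)"
proof -
  define z where "z = round (2 ^ k * \<theta>)"
  have pow: "2 ^ (n + Suc k) * \<theta> = 2 ^ n * (2 * (2 ^ k * \<theta>))" by (simp add: power_add)
  have "\<bar>2 ^ k * \<theta> - of_int z\<bar> = \<theta> / 2" using assms(1) by (simp add: int_dist_def z_def)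
  then consider "2 * (2 ^ k * \<theta>) = \<theta> + 2 * of_int z" | "2 * (2 ^ k * \<theta>) = - \<theta> + 2 * of_int z" by linarith
  then show ?thesis
  proof cases
    case 1
    have "2 ^ (n + Suc k) * \<theta> = 2 ^ n * \<theta> + of_int (2 ^ n * (2 * z))"
      unfolding pow 1 by (simp add: algebra_simps)
    then show ?thesis by (metis int_dist_add_int)
  next
    case 2
    have "2 ^ (n + Suc k) * \<theta> = - (2 ^ n * \<theta>) + of_int (2 ^ n * (2 * z))"
      unfolding pow 2 by (simp add: algebra_simps)
    then show ?thesis by (metis int_dist_add_int int_dist_minus)
  qed
qed

text \<open>
  For a positive \<open>gap\<close> the average stops at \<open>k\<close>. In the critical case, where the \<open>gap\<close> vanishes, terms and
  weights repeat with period \<open>p = k + 1\<close> and factor \<open>2\<^sup>-\<^sup>p\<close>. Numerator and denominator of the infinite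
  average are then the partial ones divided by the same number \<open>1 - 2\<^sup>-\<^sup>p\<close>.
\<close>
lemma clipped_average_eq_partial_average:
  assumes \<eta>: "0 < \<eta>" and k: "survives \<eta> 1 k" "0 \<le> gap \<eta> k"
  shows "clipped_average \<eta> = partial_average \<eta> (Suc k)"
proof (cases "gap \<eta> k = 0")
  case False
  then have dead: "weight \<eta> n = 0" if "n \<notin> {..<Suc k}" for n
    using that k by (auto simp: weight_def survives_one_gap not_le intro!: exI[of _ k])
  have "(\<Sum>n. weight \<eta> n * f n) = (\<Sum>n<Suc k. (1/2) ^ n * f n)" for f :: "nat \<Rightarrow> real"
    using dead weight_before[OF k(1)] by (subst suminf_finite[of "{..<Suc k}"]) auto
  from this[of "clipped_dist \<eta>"] this[of "\<lambda>_. 1"] show ?thesis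
    by (simp add: clipped_average_def partial_average_def total_weight_def)
next
  case True
  let ?p = "Suc k" and ?a = "clipped_dist \<eta>"
  have dist: "int_dist (2 ^ (n + ?p) / \<eta>) = int_dist (2 ^ n / \<eta>)" for n
    using int_dist_restart[of k "1 / \<eta>" n] True \<eta> by (simp add: gap_def)
  have gap: "gap \<eta> (n + ?p) = gap \<eta> n" and a: "?a (n + ?p) = ?a n" for n
    unfolding gap_def clipped_dist_def dist by simp_all
  have sp: "survives \<eta> 1 ?p" using k True by (auto simp: survives_one_gap less_Suc_eq)
  have "survives \<eta> 1 (n + ?p) \<longleftrightarrow> survives \<eta> 1 n" for n
  proof
    assume s: "survives \<eta> 1 (n + ?p)"
    show "survives \<eta> 1 n" unfolding survives_one_gap
    proof (intro allI impI)
      fix j assume "j < n"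
      then have "gap \<eta> (j + ?p) \<le> 0" using s unfolding survives_one_gap by simp
      then show "gap \<eta> j \<le> 0" by (simp only: gap)
    qed
  next
    assume s: "survives \<eta> 1 n"
    show "survives \<eta> 1 (n + ?p)" unfolding survives_one_gap
    proof (intro allI impI)
      fix j assume j: "j < n + ?p"
      show "gap \<eta> j \<le> 0"
      proof (cases "j < ?p")
        case False
        then have "gap \<eta> j = gap \<eta> (j - ?p)" using gap[of "j - ?p"] by simp
        then show ?thesis using s j False unfolding survives_one_gap by simp
      qed (use sp in \<open>simp add: survives_one_gap\<close>)
    qed
  qed
  then have w: "weight \<eta> (n + ?p) = weight \<eta> n * (1/2) ^ ?p" for n
    by (simp add: weight_def power_add)
  \<comment> \<open>used for the numerator and, with \<open>f = 1\<close>, for the denominator\<close>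
  have renewal: "(\<Sum>n. weight \<eta> n * f n) * (1 - (1/2) ^ ?p) = (\<Sum>n<?p. (1/2) ^ n * f n)"
    if "\<And>n. f (n + ?p) = f n" "summable (\<lambda>n. weight \<eta> n * f n)" for f :: "nat \<Rightarrow> real"
  proof -
    have "(\<Sum>n. weight \<eta> n * f n) = (\<Sum>n. weight \<eta> (n + ?p) * f (n + ?p)) + (\<Sum>n<?p. weight \<eta> n * f n)"
      by (rule suminf_split_initial_segment[OF that(2)])
    also have "(\<Sum>n. weight \<eta> (n + ?p) * f (n + ?p)) = (\<Sum>n. weight \<eta> n * f n * (1/2) ^ ?p)"
      unfolding w that(1) by (simp add: mult_ac)
    also have "\<dots> = (\<Sum>n. weight \<eta> n * f n) * (1/2) ^ ?p"
      by (rule suminf_mult2[OF that(2), symmetric])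
    also have "(\<Sum>n<?p. weight \<eta> n * f n) = (\<Sum>n<?p. (1/2) ^ n * f n)"
      using weight_before[OF sp] by (intro sum.cong) auto
    finally show ?thesis by (simp only: right_diff_distrib mult_1_right)
  qed
  have pos: "0 < 1 - (1/2::real) ^ ?p"
    using power_Suc_less_one[of "1/2::real" k] by simp
  have "clipped_average \<eta> = ((\<Sum>n. weight \<eta> n * ?a n) * (1 - (1/2) ^ ?p)) / (total_weight \<eta> * (1 - (1/2) ^ ?p))"
    unfolding clipped_average_def using pos by (simp only: mult_divide_mult_cancel_right)
  also have "\<dots> = partial_average \<eta> ?p"
    using renewal[OF a summable_weight_clipped[OF \<eta>]] renewal[of "\<lambda>_. 1"] summable_weight[of \<eta>]
    unfolding partial_average_def total_weight_def by simp
  finally show ?thesis .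
qed

lemma continuous_on_gap: "continuous_on {1..2} (\<lambda>\<eta>. gap \<eta> j)"
  unfolding gap_def by (intro continuous_intros) auto

lemma continuous_on_partial_average:
  assumes "0 < k" shows "continuous_on {1..2} (\<lambda>\<eta>. partial_average \<eta> k)"
  unfolding partial_average_def clipped_dist_def
  using sum_half_powers_pos[OF assms] by (intro continuous_intros) auto

text \<open>
  For \<open>\<eta>\<close> close to \<open>x\<close>, the first \<open>N\<close> gaps that are non-zero at \<open>x\<close> keep their sign. If \<open>\<eta>\<close> survives \<open>N\<close>
  steps, so does \<open>x\<close>, and both averages are close to the continuous partial average of length \<open>N\<close>.
  Otherwise \<open>\<eta>\<close> stops at some \<open>k < N\<close>, where the gap of \<open>x\<close> is non-negative, and both averages equal the partial
  average of length \<open>k + 1\<close>.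
\<close>
lemma continuous_on_clipped_average: "continuous_on {1..2} clipped_average"
  unfolding continuous_on_def
proof (intro ballI tendstoI)
  fix x :: real and e :: real assume x: "x \<in> {1..2}" and "0 < e"
  let ?F = "at x within {1..2}"
  obtain N0 where N0: "(1/2::real) ^ N0 < e / 3"
    using real_arch_pow_inv[of "e / 3" "1/2"] \<open>0 < e\<close> by auto
  define N where "N = Suc N0"
  have N: "(1/2::real) ^ N < e / 3" "0 < N" using N0 unfolding N_def by (auto simp: field_simps)
  have tg: "((\<lambda>\<eta>. gap \<eta> j) \<longlongrightarrow> gap x j) ?F" for j
    using continuous_on_gap x by (simp add: continuous_on_def)
  have sign: "eventually (\<lambda>\<eta>. \<forall>j\<in>{..<N}. gap \<eta> j \<le> 0 \<longrightarrow> gap x j \<le> 0) ?F"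
  proof (intro eventually_ball_finite ballI)
    fix j
    show "eventually (\<lambda>\<eta>. gap \<eta> j \<le> 0 \<longrightarrow> gap x j \<le> 0) ?F"
    proof (cases "gap x j \<le> 0")
      case False
      then have "eventually (\<lambda>\<eta>. 0 < gap \<eta> j) ?F" by (intro order_tendstoD(1)[OF tg]) simp
      then show ?thesis by eventually_elim simp
    qed simp
  qed simp
  have sign': "eventually (\<lambda>\<eta>. \<forall>j\<in>{..<N}. 0 < gap \<eta> j \<longrightarrow> 0 \<le> gap x j) ?F"
  proof (intro eventually_ball_finite ballI)
    fix j
    show "eventually (\<lambda>\<eta>. 0 < gap \<eta> j \<longrightarrow> 0 \<le> gap x j) ?F"
    proof (cases "0 \<le> gap x j")
      case False
      then have "eventually (\<lambda>\<eta>. gap \<eta> j < 0) ?F" by (intro order_tendstoD(2)[OF tg]) simp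
      then show ?thesis by eventually_elim simp
    qed simp
  qed simp
  have close: "eventually (\<lambda>\<eta>. \<forall>k\<in>{..N}. 0 < k \<longrightarrow> dist (partial_average \<eta> k) (partial_average x k) < e / 3) ?F"
  proof (intro eventually_ball_finite ballI)
    fix k
    show "eventually (\<lambda>\<eta>. 0 < k \<longrightarrow> dist (partial_average \<eta> k) (partial_average x k) < e / 3) ?F"
    proof (cases "0 < k")
      case True
      then have "((\<lambda>\<eta>. partial_average \<eta> k) \<longlongrightarrow> partial_average x k) ?F"
        using continuous_on_partial_average x by (simp add: continuous_on_def)
      from tendstoD[OF this, of "e / 3"] \<open>0 < e\<close> show ?thesis by (auto elim: eventually_mono)
    qed simp
  qed simp
  have dom: "eventually (\<lambda>\<eta>. \<eta> \<in> {1..2}) ?F" by (simp add: eventually_at_filter)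
  show "eventually (\<lambda>\<eta>. dist (clipped_average \<eta>) (clipped_average x) < e) ?F"
    using sign sign' close dom
  proof eventually_elim
    case (elim \<eta>)
    have transfer: "survives x 1 k" if "survives \<eta> 1 k" "k \<le> N" for k
      using that elim(1) by (auto simp: survives_one_gap)
    show ?case
    proof (cases "survives \<eta> 1 N")
      case True
      have "\<bar>clipped_average \<eta> - partial_average \<eta> N\<bar> < e / 3"
        using clipped_average_approx[of \<eta> N] True N elim(4) by simp
      moreover have "\<bar>clipped_average x - partial_average x N\<bar> < e / 3"
        using clipped_average_approx[of x N] transfer[OF True] N x by simp
      moreover have "\<bar>partial_average \<eta> N - partial_average x N\<bar> < e / 3"
        using elim(3) N by (simp add: dist_real_def)
      ultimately show ?thesis unfolding dist_real_def by linarith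
    next
      case False
      then obtain k where k: "k < N" "0 < gap \<eta> k" "\<And>j. j < k \<Longrightarrow> \<not> (j < N \<and> 0 < gap \<eta> j)"
        using exists_least_iff[of "\<lambda>k. k < N \<and> 0 < gap \<eta> k"] by (auto simp: survives_one_gap not_le)
      then have s: "survives \<eta> 1 k" by (auto simp: survives_one_gap not_less)
      have "clipped_average \<eta> = partial_average \<eta> (Suc k)"
        using clipped_average_eq_partial_average[OF _ s] k elim(4) by simp
      moreover have "clipped_average x = partial_average x (Suc k)"
        using clipped_average_eq_partial_average[OF _ transfer[OF s]] k elim(2) x by simp
      moreover have "dist (partial_average \<eta> (Suc k)) (partial_average x (Suc k)) < e / 3"
        using elim(3) k by simp
      ultimately show ?thesis using \<open>0 < e\<close> by simp
    qed
  qed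
qed

lemma inv_measure_eq_acim: "1 < \<eta> \<Longrightarrow> \<eta> \<le> 2 \<Longrightarrow> inv_measure \<eta> = acim \<eta>"
  unfolding inv_measure_def
  using invariant_ac_prob_acim invariant_ac_prob_unique by (auto intro!: the_equality)

lemma measure_inv_measure_central:
  assumes "1 \<le> \<eta>" "\<eta> \<le> 2"
  shows "measure (inv_measure \<eta>) {-1/2..1/2} = 1 / (2 * \<eta>) + clipped_average \<eta>"
proof (cases "\<eta> = 1")
  case False
  then show ?thesis using inv_measure_eq_acim[of \<eta>] measure_acim_central[of \<eta>] assms by simp
next
  case True
  have "clipped_dist 1 n = 0" for n
    using int_dist_add_int[of 0 "2 ^ n"] int_dist_unit[of 0] by (simp add: clipped_dist_def)
  then have "clipped_average 1 = 0" by (simp add: clipped_average_def)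
  moreover have "measure (uniform_measure (restrict_space lborel {-1..1::real}) {-1..1}) {-1/2..1/2} = 1/2"
  proof -
    have m: "emeasure (restrict_space lborel {-1..1::real}) A = emeasure lborel A" if "A \<subseteq> {-1..1}" for A
      using that by (intro emeasure_restrict_space) auto
    have "{-1/2..1/2::real} \<in> sets (restrict_space lborel {-1..1})"
      by (subst sets_restrict_space_iff) auto
    then show ?thesis
      by (subst measure_uniform_measure) (auto simp: m measure_def Int_absorb1 subset_eq)
  qed
  ultimately show ?thesis using True by (simp add: inv_measure_def)
qed

section \<open>The formula in terms of digits\<close>
lemma length_digit_word: "length (digit_word \<eta> n x) = n"
  by (simp add: digit_word_def)

lemma digit_word_nth: "j < n \<Longrightarrow> digit_word \<eta> n x ! j = first_digit ((sym_doubling \<eta> ^^ j) x)"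
  by (simp add: digit_word_def digit_def del: upt_Suc)

lemma take_digit_word: "k \<le> n \<Longrightarrow> take k (digit_word \<eta> n x) = digit_word \<eta> k x"
  by (rule nth_equalityI) (auto simp: length_digit_word digit_word_nth)

lemma word_value_take_Suc:
  assumes "k < length w"
  shows "word_value (take (Suc k) w) = word_value (take k w) + of_int (w ! k) / 2 ^ Suc k"
proof -
  have "word_value (take n w) = (\<Sum>j=1..n. of_int (w ! (j - 1)) / 2 ^ j)" if "n \<le> length w" for n
    unfolding word_value_def using that by (intro sum.cong) auto
  from this[of k] this[of "Suc k"] assms show ?thesis by simp
qed

lemma orbit_eq_word_value:
  assumes "k \<le> length w" "\<And>j. j < k \<Longrightarrow> w ! j = first_digit ((sym_doubling \<eta> ^^ j) x)"
  shows "(sym_doubling \<eta> ^^ k) x = 2 ^ k * (x - \<eta> * word_value (take k w))"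
  using assms
proof (induction k)
  case 0
  then show ?case by (simp add: word_value_def)
next
  case (Suc k)
  have "(sym_doubling \<eta> ^^ Suc k) x = 2 * (2 ^ k * (x - \<eta> * word_value (take k w))) - of_int (w ! k) * \<eta>"
    using Suc.IH Suc.prems sym_doubling_def[of \<eta> "(sym_doubling \<eta> ^^ k) x"] by simp
  also have "\<dots> = 2 ^ Suc k * (x - \<eta> * word_value (take (Suc k) w))"
    using Suc.prems word_value_take_Suc[of k w] by (simp add: field_simps)
  finally show ?case .
qed

abbreviation positions :: "int list \<Rightarrow> int \<Rightarrow> nat \<Rightarrow> nat set" where
  "positions w d k \<equiv> {j \<in> {1..k}. w ! (j - 1) = d}"

lemma positions_Suc:
  "positions w d (Suc k) = (if w ! k = d then insert (Suc k) (positions w d k) else positions w d k)"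
  by (auto simp: le_Suc_eq)

text \<open>
  The induction step adds, with \<open>v = v(w\<^sub>1 \<dots> w\<^sub>k)\<close>, the term \<open>1 - \<eta> v + 2\<^sup>-\<^sup>k\<^sup>-\<^sup>1\<close> for the digit \<open>0\<close> and
  \<open>\<eta> 2\<^sup>-\<^sup>k - 1 + \<eta> v + 2\<^sup>-\<^sup>k\<^sup>-\<^sup>1\<close> for the digit \<open>1\<close>. In the latter, \<open>\<eta> 2\<^sup>-\<^sup>k\<close> splits into two halves \<open>\<eta> 2\<^sup>-\<^sup>k\<^sup>-\<^sup>1\<close>:
  one extends \<open>v\<close> to \<open>v(w\<^sub>1 \<dots> w\<^sub>k\<^sub>+\<^sub>1)\<close>, the other contributes to the value of the whole word.
\<close>
lemma central_sum_before_matching: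
  assumes \<eta>: "1 < \<eta>" "\<eta> \<le> 2" and m: "\<And>n. survives \<eta> 1 n \<longleftrightarrow> n < m" and w: "w = digit_word \<eta> (m - 1) 1"
    and k: "k \<le> m - 1"
  shows "(\<Sum>n<k. (1/2) ^ n * (\<eta> * clipped_dist \<eta> n + 1/2))
    = 1 - (1/2) ^ k + card (positions w 0 k) - card (positions w 1 k)
      + \<eta> * (word_value (take k w) + (\<Sum>j\<in>positions w 1 k. word_value (take j w))
             - (\<Sum>j\<in>positions w 0 k. word_value (take j w)))"
  using k
proof (induction k)
  case 0
  then show ?case by (simp add: word_value_def)
next
  case (Suc k)
  let ?t = "orbit_one \<eta> k" and ?v = "word_value (take k w)"
  have len: "length w = m - 1" by (simp add: w length_digit_word)
  have dig: "w ! j = first_digit (orbit_one \<eta> j)" if "j < m - 1" for j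
    using that by (simp add: w digit_word_nth)
  have t: "?t = 2 ^ k * (1 - \<eta> * ?v)"
    using Suc.prems len dig by (intro orbit_eq_word_value) auto
  have "survives \<eta> 1 k" "survives \<eta> 1 (Suc k)" using m Suc.prems by auto
  then have mem: "\<eta> - 1 \<le> ?t" "?t \<le> 1" using orbit_one_mem[of \<eta> k] \<eta> by auto
  have dist: "int_dist (2 ^ k / \<eta>) = min ?t (\<eta> - ?t) / \<eta>"
    using int_dist_gap(1)[of \<eta> ?t] int_dist_orbit[of \<eta> k 1] mem \<eta> by simp
  have "int_dist (2 ^ k / \<eta>) \<le> 1 / (2 * \<eta>)"
    using \<open>survives \<eta> 1 (Suc k)\<close> by (simp add: survives_def)
  then have clip: "\<eta> * clipped_dist \<eta> k = min ?t (\<eta> - ?t)" "min ?t (\<eta> - ?t) \<le> 1/2"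
    using dist \<eta> by (auto simp: clipped_dist_def field_simps)
  have val: "word_value (take (Suc k) w) = ?v + of_int (w ! k) * (1/2) ^ Suc k"
    using Suc.prems len word_value_take_Suc[of k w] by (simp add: power_one_over)
  have fin: "finite (positions w d k)" "Suc k \<notin> positions w d k" for d by auto
  have IH: "(\<Sum>n<k. (1/2) ^ n * (\<eta> * clipped_dist \<eta> n + 1/2))
    = 1 - (1/2) ^ k + card (positions w 0 k) - card (positions w 1 k)
      + \<eta> * (?v + (\<Sum>j\<in>positions w 1 k. word_value (take j w))
             - (\<Sum>j\<in>positions w 0 k. word_value (take j w)))"
    using Suc by simp
  show ?case
  proof (cases "?t \<le> 1/2")
    case True
    then have d: "w ! k = 0" using dig[of k] Suc.prems mem \<eta> by (simp add: first_digit_def)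
    have "\<eta> * clipped_dist \<eta> k = ?t" using clip True \<eta> mem by (auto simp: min_def)
    then have T: "(1/2) ^ k * (\<eta> * clipped_dist \<eta> k + 1/2) = 1 - \<eta> * ?v + (1/2) ^ Suc k"
      unfolding t by (simp add: power_one_over field_simps)
    show ?thesis
      unfolding sum.lessThan_Suc IH T positions_Suc d using fin by (simp add: val d algebra_simps)
  next
    case False
    then have d: "w ! k = 1" using dig[of k] Suc.prems mem \<eta> by (simp add: first_digit_def)
    have "\<eta> * clipped_dist \<eta> k = \<eta> - ?t" using clip False \<eta> mem by (auto simp: min_def split: if_splits)
    then have T: "(1/2) ^ k * (\<eta> * clipped_dist \<eta> k + 1/2) = \<eta> * (1/2) ^ k - 1 + \<eta> * ?v + (1/2) ^ Suc k"
      unfolding t by (simp add: power_one_over field_simps)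
    show ?thesis
      unfolding sum.lessThan_Suc IH T positions_Suc d using fin by (simp add: val d algebra_simps)
  qed
qed

text \<open>
  The last step before matching contributes \<open>2\<^sup>-\<^sup>(\<^sup>m\<^sup>-\<^sup>1\<^sup>)\<close>, which cancels the geometric remainder in
  \<open>central_sum_before_matching\<close>. What is left of the constant term is \<open>1\<close>; for \<open>m \<ge> 2\<close> it is cancelled by the first digit,
  which is \<open>1\<close>, and this is why \<open>c\<close> counts digits from position \<open>2\<close> only.
\<close>
lemma central_measure_formula:
  assumes \<eta>: "1 \<le> \<eta>" "\<eta> \<le> 2" and mi: "matching_index \<eta> = enat m"
  defines "w \<equiv> digit_word \<eta> (m - 1) 1"
  shows "measure (inv_measure \<eta>) {-1/2..1/2}
       = 2 ^ (m - 1) / (2 ^ m - 1) * (real_of_int (const_c m w) / \<eta> + const_K m w)"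
proof -
  note M = survives_iff_less_matching_index[OF \<eta> mi]
  define k where "k = m - 1"
  have mk: "m = Suc k" using M(2) by (simp add: k_def)
  have len: "length w = k" by (simp add: w_def k_def length_digit_word)
  have alive: "survives \<eta> 1 k" "\<not> survives \<eta> 1 (Suc k)" using M(3) mk by auto
  then have "0 < gap \<eta> k" by (auto simp: survives_one_gap less_Suc_eq not_le)
  then have avg: "clipped_average \<eta> = partial_average \<eta> m"
    using clipped_average_eq_partial_average[of \<eta> k] alive(1) M(1) mk by simp
  have last: "\<eta> * clipped_dist \<eta> k + 1/2 = 1"
    using \<open>0 < gap \<eta> k\<close> M(1) by (simp add: clipped_dist_def gap_def min_def)
  have Z: "(\<Sum>n<m. (1/2::real) ^ n) = (2 ^ m - 1) / 2 ^ k"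
    by (subst sum_gp_strict) (simp add: mk power_one_over field_simps)
  have Zpos: "0 < (2::real) ^ m - 1" using M(2) by simp
  have "1 / (2 * \<eta>) + clipped_average \<eta>
      = (\<Sum>n<m. (1/2) ^ n * (\<eta> * clipped_dist \<eta> n + 1/2)) / (\<eta> * (\<Sum>n<m. (1/2) ^ n))"
  proof -
    have "(\<Sum>n<m. (1/2) ^ n * (\<eta> * clipped_dist \<eta> n + 1/2))
        = \<eta> * (\<Sum>n<m. (1/2) ^ n * clipped_dist \<eta> n) + (\<Sum>n<m. (1/2) ^ n) / 2"
      by (simp add: sum.distrib sum_distrib_left sum_divide_distrib distrib_left mult_ac)
    moreover have "1 / (2 * \<eta>) + A / Z = (\<eta> * A + Z / 2) / (\<eta> * Z)" if "0 < Z" for A Z :: real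
      using that M(1) by (simp add: field_simps)
    ultimately show ?thesis
      unfolding avg partial_average_def using sum_half_powers_pos[of m] M(2) by simp
  qed
  also have "(\<Sum>n<m. (1/2) ^ n * (\<eta> * clipped_dist \<eta> n + 1/2))
     = of_int (const_c m w) + \<eta> * const_K m w"
  proof -
    have S: "(\<Sum>n<m. (1/2) ^ n * (\<eta> * clipped_dist \<eta> n + 1/2))
      = 1 + real (card (positions w 0 k)) - real (card (positions w 1 k))
      + \<eta> * (word_value w + (\<Sum>j\<in>positions w 1 k. word_value (take j w))
             - (\<Sum>j\<in>positions w 0 k. word_value (take j w)))"
      using central_sum_before_matching[OF M(1) \<eta>(2) M(3) w_def[THEN meta_eq_to_obj_eq], of k] last len
      by (simp add: mk)
    show ?thesis
    proof (cases "m = 1")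
      case True
      then show ?thesis unfolding S using len by (simp add: mk const_c_def const_K_def word_value_def)
    next
      case False
      then have "0 < k" using mk by simp
      then have w0: "w ! 0 = 1"
        unfolding w_def using mk by (simp add: digit_word_nth first_digit_def)
      have "positions w 0 k = {j \<in> {2..k}. w ! (j - 1) = 0}"
      proof (intro Collect_cong)
        fix j
        show "j \<in> {1..k} \<and> w ! (j - 1) = 0 \<longleftrightarrow> j \<in> {2..k} \<and> w ! (j - 1) = 0"
          using w0 by (cases "j = 1") auto
      qed
      moreover have "positions w 1 k = insert 1 {j \<in> {2..k}. w ! (j - 1) = 1}"
        using w0 \<open>0 < k\<close> by (auto simp: Suc_le_eq)
      ultimately show ?thesis
        unfolding S using False by (simp add: const_c_def const_K_def mk)
    qed
  qed
  finally have "1 / (2 * \<eta>) + clipped_average \<eta>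
     = (of_int (const_c m w) + \<eta> * const_K m w) / (\<eta> * ((2 ^ m - 1) / 2 ^ k))" unfolding Z .
  also have "\<dots> = 2 ^ (m - 1) / (2 ^ m - 1) * (of_int (const_c m w) / \<eta> + const_K m w)"
    using M(1) Zpos by (simp add: mk field_simps)
  finally show ?thesis using measure_inv_measure_central[OF \<eta>] by simp
qed

theorem theorem2:
  shows "continuous_on {1..2} (\<lambda>\<eta>. measure (inv_measure \<eta>) {-1/2..1/2})
    \<and> (\<forall>m J. matching_interval m J \<longrightarrow>
          mono_on J (\<lambda>\<eta>. measure (inv_measure \<eta>) {-1/2..1/2})
        \<or> antimono_on J (\<lambda>\<eta>. measure (inv_measure \<eta>) {-1/2..1/2}))
    \<and> (\<forall>m J. matching_interval m J \<longrightarrow>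
          (\<exists>w. \<forall>\<eta>\<in>J. digit_word \<eta> (m - 1) 1 = w \<and>
             measure (inv_measure \<eta>) {-1/2..1/2} =
               2 ^ (m - 1) / (2 ^ m - 1) * (real_of_int (const_c m w) / \<eta> + const_K m w)))"
proof -
  let ?f = "\<lambda>\<eta>. measure (inv_measure \<eta>) {-1/2..1/2}"
  have "continuous_on {1..2} (\<lambda>\<eta>. 1 / (2 * \<eta>) + clipped_average \<eta>)"
    by (intro continuous_intros continuous_on_clipped_average) auto
  then have cont: "continuous_on {1..2} ?f"
    by (rule continuous_on_eq) (metis atLeastAtMost_iff measure_inv_measure_central)
  have formula: "\<exists>w. \<forall>\<eta>\<in>J. digit_word \<eta> (m - 1) 1 = w \<and>
      ?f \<eta> = 2 ^ (m - 1) / (2 ^ m - 1) * (real_of_int (const_c m w) / \<eta> + const_K m w)"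
    if "matching_interval m J" for m J
  proof -
    from that obtain v where J: "J \<subseteq> {1..2}" "\<forall>\<eta>\<in>J. matching_index \<eta> = enat m"
      "\<forall>\<eta>\<in>J. digit_word \<eta> m 1 = v"
      unfolding matching_interval_def constant_matching_on_def by blast
    show ?thesis
    proof (intro exI[of _ "take (m - 1) v"] ballI conjI)
      fix \<eta> assume "\<eta> \<in> J"
      with J have h: "1 \<le> \<eta>" "\<eta> \<le> 2" "matching_index \<eta> = enat m" "digit_word \<eta> m 1 = v" by auto
      show w: "digit_word \<eta> (m - 1) 1 = take (m - 1) v" using take_digit_word[of "m - 1" m \<eta> 1] h(4) by simp
      show "?f \<eta> = 2 ^ (m - 1) / (2 ^ m - 1) * (real_of_int (const_c m (take (m - 1) v)) / \<eta> + const_K m (take (m - 1) v))"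
        using central_measure_formula[OF h(1-3)] unfolding w .
    qed
  qed
  have mono: "mono_on J ?f \<or> antimono_on J ?f" if MJ: "matching_interval m J" for m J
  proof -
    obtain w where w: "\<And>\<eta>. \<eta> \<in> J \<Longrightarrow>
        ?f \<eta> = 2 ^ (m - 1) / (2 ^ m - 1) * (real_of_int (const_c m w) / \<eta> + const_K m w)"
      using formula[OF MJ] by blast
    have pos: "0 < \<eta>" if "\<eta> \<in> J" for \<eta>
      using MJ that unfolding matching_interval_def constant_matching_on_def by force
    have factor: "0 \<le> 2 ^ (m - 1) / (2 ^ m - 1 :: real)" by simp
    show ?thesis
    proof (cases "0 \<le> const_c m w")
      case True
      have "antimono_on J ?f"
      proof (rule monotone_onI)
        fix r s assume rs: "r \<in> J" "s \<in> J" "r \<le> s"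
        then have "real_of_int (const_c m w) / s \<le> real_of_int (const_c m w) / r"
          using True pos by (intro divide_left_mono) auto
        then show "?f s \<le> ?f r"
          unfolding w[OF rs(1)] w[OF rs(2)] by (intro mult_left_mono factor) simp
      qed
      then show ?thesis ..
    next
      case False
      have "mono_on J ?f"
      proof (rule mono_onI)
        fix r s assume rs: "r \<in> J" "s \<in> J" "r \<le> s"
        then have "real_of_int (const_c m w) / r \<le> real_of_int (const_c m w) / s"
          using False pos by (intro divide_left_mono_neg) auto
        then show "?f r \<le> ?f s"
          unfolding w[OF rs(1)] w[OF rs(2)] by (intro mult_left_mono factor) simp
      qed
      then show ?thesis ..
    qed
  qed
  show ?thesis using cont mono formula by blast
qed

end
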